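(* Let $\mathbf G$ be a spray on a manifold $M$ with each of its geodesics $x=x(t)$ being defined on the maximal interval $I$ given by one case of the following: $$I=(a,b),\quad\text{or}\quad I=(a,+\infty),\quad\text{or}\quad I=(-\infty,b),$$ where $a=a(u,v)<0$, $b=b(u,v)>0$, with $u=x(0)$, $v=x'(0)$, are $C^\infty$ functions on a conical region $\mathcal C$ of $TM\setminus\{0\}$. Then $\mathbf G$ is projectively (positively/negatively) complete on $\mathcal C$.
   Context: A spray $\mathbf G$ on a manifold $M$ is a smooth vector field on a conical region of $TM\setminus\{0\}$ of the form $\mathbf G=y^i\frac{\partial}{\partial x^i}-2G^i\frac{\partial}{\partial y^i}$ in local coordinates $(x^i,y^i)$ of $TM$, where $G^i(x,\lambda y)=\lambda^2G^i(x,y)$ for $\lambda>0$. Its geodesics are the projections to $M$ of its integral curves, i.e. the curves satisfying $\frac{d^2x^i}{dt^2}+2G^i(x,\frac{dx}{dt})=0$; here $t$ is called a geodesic parameter. A spray is complete (resp. positively complete, negatively complete) if every geodesic, in its geodesic parameter, extends to be defined on $(-\infty,+\infty)$ (resp. for all parameters up to $+\infty$, resp. for all parameters down to $-\infty$). Two sprays $\mathbf G,\bar{\mathbf G}$ are (pointwise) projectively related if $\bar G^i=G^i+Py^i$ for some function $P=P(x,y)$; they then have the same geodesics as point sets. $\mathbf G$ is projectively complete (resp. projectively positively complete, projectively negatively complete) on $\mathcal C$ if there is a spray $\bar{\mathbf G}$ on $\mathcal C$ projectively related to $\mathbf G$ that is complete (resp. positively complete, negatively complete). *)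

theory Defs
  imports "HOL-Analysis.Analysis"
begin

subsection \<open>Smooth maps on open subsets of normed spaces\<close>

text \<open>Both notions are only used for open \<open>S\<close>.\<close>

primrec ck_on :: "nat \<Rightarrow> 'a::real_normed_vector set \<Rightarrow> ('a \<Rightarrow> 'b::real_normed_vector) \<Rightarrow> bool" where
  "ck_on 0 S f \<longleftrightarrow> continuous_on S f"
| "ck_on (Suc k) S f \<longleftrightarrow>
     (\<forall>x\<in>S. f differentiable (at x)) \<and> (\<forall>h. ck_on k S (\<lambda>x. frechet_derivative f (at x) h))"

definition smooth_on :: "'a::real_normed_vector set \<Rightarrow> ('a \<Rightarrow> 'b::real_normed_vector) \<Rightarrow> bool" where
  "smooth_on S f \<longleftrightarrow> (\<forall>k. ck_on k S f)"


subsection \<open>Smooth manifolds\<close>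

text \<open>
  A manifold is given by an atlas on a set of points; the topology is the one induced by the
  atlas. A chart is a pair of its domain and its coordinate map, whose values outside the domain
  are irrelevant. The model space \<open>'e\<close> plays the role of \<open>\<real>\<^sup>n\<close>.
\<close>

type_synonym ('m, 'e) chart = "'m set \<times> ('m \<Rightarrow> 'e)"

definition chart_inv :: "('m, 'e) chart \<Rightarrow> 'e \<Rightarrow> 'm" where
  "chart_inv c = inv_into (fst c) (snd c)"

definition transition :: "('m, 'e) chart \<Rightarrow> ('m, 'e) chart \<Rightarrow> 'e \<Rightarrow> 'e" where
  "transition c d = snd d \<circ> chart_inv c"

definition manifold_points :: "('m, 'e) chart set \<Rightarrow> 'm set" where
  "manifold_points A = (\<Union>c\<in>A. fst c)"

definition smooth_atlas :: "('m, 'e::euclidean_space) chart set \<Rightarrow> bool" where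
  "smooth_atlas A \<longleftrightarrow>
     (\<forall>c\<in>A. inj_on (snd c) (fst c)) \<and>
     (\<forall>c\<in>A. \<forall>d\<in>A. open (snd c ` (fst c \<inter> fst d)) \<and>
                   smooth_on (snd c ` (fst c \<inter> fst d)) (transition c d))"

definition atlas_topology :: "('m, 'e::euclidean_space) chart set \<Rightarrow> 'm topology" where
  "atlas_topology A =
     topology (\<lambda>W. W \<subseteq> manifold_points A \<and> (\<forall>c\<in>A. open (snd c ` (fst c \<inter> W))))"

lemma openin_atlas_topology:
  assumes inj: "\<And>c. c \<in> A \<Longrightarrow> inj_on (snd c) (fst c)"
  shows "openin (atlas_topology A) W \<longleftrightarrow>
           W \<subseteq> manifold_points A \<and> (\<forall>c\<in>A. open (snd c ` (fst c \<inter> W)))"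
proof -
  let ?P = "\<lambda>W. W \<subseteq> manifold_points A \<and> (\<forall>c\<in>A. open (snd c ` (fst c \<inter> W)))"
  have int: "?P (S \<inter> T)" if S: "?P S" and T: "?P T" for S T
  proof -
    have "snd c ` (fst c \<inter> (S \<inter> T)) = snd c ` (fst c \<inter> S) \<inter> snd c ` (fst c \<inter> T)"
      if "c \<in> A" for c
      using inj_on_image_Int[OF inj[OF that], of "fst c \<inter> S" "fst c \<inter> T"]
      by (simp add: Int_ac)
    with S T show ?thesis by auto
  qed
  have un: "?P (\<Union>K)" if "\<forall>S\<in>K. ?P S" for K
  proof -
    have "snd c ` (fst c \<inter> \<Union>K) = (\<Union>S\<in>K. snd c ` (fst c \<inter> S))" for c :: "('a, 'b) chart"
      by blast
    with that show ?thesis by auto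
  qed
  have "istopology ?P"
    unfolding istopology_def using int un by simp
  then show ?thesis
    unfolding atlas_topology_def by (simp add: topology_inverse')
qed

definition smooth_manifold :: "('m, 'e::euclidean_space) chart set \<Rightarrow> bool" where
  "smooth_manifold A \<longleftrightarrow>
     smooth_atlas A \<and> Hausdorff_space (atlas_topology A) \<and> second_countable (atlas_topology A)"

definition smooth_function :: "('m, 'e::euclidean_space) chart set \<Rightarrow> 'm set \<Rightarrow> ('m \<Rightarrow> real) \<Rightarrow> bool" where
  "smooth_function A W f \<longleftrightarrow> (\<forall>c\<in>A. smooth_on (snd c ` (fst c \<inter> W)) (f \<circ> chart_inv c))"


subsection \<open>Tangent bundle\<close>

text \<open>
  A tangent vector at \<open>p\<close> is a family assigning to each chart \<open>c\<close> around \<open>p\<close> the components of the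
  vector with respect to \<open>c\<close>, transforming by the Jacobian of the coordinate change. The family is
  set to 0 at all other charts, so that it is determined by the vector.
\<close>

type_synonym ('m, 'e) tvec = "'m \<times> (('m, 'e) chart \<Rightarrow> 'e)"

definition tangent_bundle :: "('m, 'e::euclidean_space) chart set \<Rightarrow> ('m, 'e) tvec set" where
  "tangent_bundle A = {(p, v). p \<in> manifold_points A \<and>
     (\<forall>c. c \<notin> A \<or> p \<notin> fst c \<longrightarrow> v c = 0) \<and>
     (\<forall>c\<in>A. \<forall>d\<in>A. p \<in> fst c \<inter> fst d \<longrightarrow>
        v d = frechet_derivative (transition c d) (at (snd c p)) (v c))}"

definition tangent_chart ::
    "('m, 'e::euclidean_space) chart set \<Rightarrow> ('m, 'e) chart \<Rightarrow> (('m, 'e) tvec, 'e \<times> 'e) chart" where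
  "tangent_chart A c =
     ({\<xi> \<in> tangent_bundle A. fst \<xi> \<in> fst c}, \<lambda>\<xi>. (snd c (fst \<xi>), snd \<xi> c))"

definition tangent_atlas ::
    "('m, 'e::euclidean_space) chart set \<Rightarrow> (('m, 'e) tvec, 'e \<times> 'e) chart set" where
  "tangent_atlas A = tangent_chart A ` A"

lemma inj_on_tangent_atlas:
  assumes "c \<in> A" "inj_on (snd c) (fst c)"
  shows "inj_on (snd (tangent_chart A c)) (fst (tangent_chart A c))"
proof (rule inj_onI)
  fix \<xi> \<eta>
  assume \<xi>: "\<xi> \<in> fst (tangent_chart A c)" and \<eta>: "\<eta> \<in> fst (tangent_chart A c)"
    and eq: "snd (tangent_chart A c) \<xi> = snd (tangent_chart A c) \<eta>"
  have p: "fst \<xi> = fst \<eta>"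
    using \<xi> \<eta> eq assms(2) by (auto simp: tangent_chart_def inj_on_def)
  have v: "snd \<xi> c = snd \<eta> c"
    using eq by (simp add: tangent_chart_def)
  have val: "snd \<zeta> d = (if d \<in> A \<and> fst \<zeta> \<in> fst d
      then frechet_derivative (transition c d) (at (snd c (fst \<zeta>))) (snd \<zeta> c) else 0)"
    if "\<zeta> \<in> fst (tangent_chart A c)" for \<zeta> d
  proof -
    have tb: "\<zeta> \<in> tangent_bundle A" and dom: "fst \<zeta> \<in> fst c"
      using that by (simp_all add: tangent_chart_def)
    show ?thesis
    proof (cases "d \<in> A \<and> fst \<zeta> \<in> fst d")
      case True
      have "\<forall>c\<in>A. \<forall>d\<in>A. fst \<zeta> \<in> fst c \<inter> fst d \<longrightarrow>
          snd \<zeta> d = frechet_derivative (transition c d) (at (snd c (fst \<zeta>))) (snd \<zeta> c)"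
        using tb unfolding tangent_bundle_def mem_Collect_eq split_beta by (elim conjE)
      then have "snd \<zeta> d = frechet_derivative (transition c d) (at (snd c (fst \<zeta>))) (snd \<zeta> c)"
        using assms(1) True dom by blast
      with True show ?thesis
        by (simp only: if_True simp_thms)
    next
      case False
      have "\<forall>d. d \<notin> A \<or> fst \<zeta> \<notin> fst d \<longrightarrow> snd \<zeta> d = 0"
        using tb unfolding tangent_bundle_def mem_Collect_eq split_beta by (elim conjE)
      with False show ?thesis
        by (simp only: if_False) blast
    qed
  qed
  have "snd \<xi> d = snd \<eta> d" for d
    unfolding val[OF \<xi>, of d] val[OF \<eta>, of d] p v by (rule refl)
  with p show "\<xi> = \<eta>"
    by (simp add: prod_eq_iff fun_eq_iff)
qed

definition tscale :: "real \<Rightarrow> ('m, 'e::euclidean_space) tvec \<Rightarrow> ('m, 'e) tvec" where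
  "tscale r \<xi> = (fst \<xi>, \<lambda>c. r *\<^sub>R snd \<xi> c)"

definition slit_tangent_bundle :: "('m, 'e::euclidean_space) chart set \<Rightarrow> ('m, 'e) tvec set" where
  "slit_tangent_bundle A = {\<xi> \<in> tangent_bundle A. snd \<xi> \<noteq> (\<lambda>_. 0)}"

definition conical_region ::
    "('m, 'e::euclidean_space) chart set \<Rightarrow> ('m, 'e) tvec set \<Rightarrow> bool" where
  "conical_region A C \<longleftrightarrow>
     C \<subseteq> slit_tangent_bundle A \<and> openin (atlas_topology (tangent_atlas A)) C \<and>
     (\<forall>\<xi>\<in>C. \<forall>r>0. tscale r \<xi> \<in> C)"


subsection \<open>Vector fields and integral curves\<close>

definition smooth_vector_field ::
    "('m, 'e::euclidean_space) chart set \<Rightarrow> 'm set \<Rightarrow> ('m \<Rightarrow> ('m, 'e) chart \<Rightarrow> 'e) \<Rightarrow> bool" where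
  "smooth_vector_field A W X \<longleftrightarrow>
     (\<forall>p\<in>W. (p, X p) \<in> tangent_bundle A) \<and>
     (\<forall>c\<in>A. smooth_on (snd c ` (fst c \<inter> W)) (\<lambda>x. X (chart_inv c x) c))"

text \<open>
  Continuity is required separately: \<open>snd c\<close> carries no information outside \<open>fst c\<close>, so
  differentiability of \<open>snd c \<circ> \<gamma>\<close> at \<open>t\<close> does not force \<open>\<gamma>\<close> to stay in the chart near \<open>t\<close>.
\<close>

definition integral_curve ::
    "('m, 'e::euclidean_space) chart set \<Rightarrow> 'm set \<Rightarrow> ('m \<Rightarrow> ('m, 'e) chart \<Rightarrow> 'e) \<Rightarrow>
     real set \<Rightarrow> (real \<Rightarrow> 'm) \<Rightarrow> bool" where
  "integral_curve A W X J \<gamma> \<longleftrightarrow>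
     open J \<and> is_interval J \<and> J \<noteq> {} \<and> \<gamma> ` J \<subseteq> W \<and>
     continuous_map (top_of_set J) (atlas_topology A) \<gamma> \<and>
     (\<forall>t\<in>J. \<forall>c\<in>A. \<gamma> t \<in> fst c \<longrightarrow>
        ((snd c \<circ> \<gamma>) has_vector_derivative X (\<gamma> t) c) (at t))"


subsection \<open>Sprays and geodesics\<close>

text \<open>A vector field on a subset of the tangent bundle, in components with respect to the charts
  \<open>tangent_chart A c\<close>.\<close>

type_synonym ('m, 'e) tfield =
  "('m, 'e) tvec \<Rightarrow> (('m, 'e) tvec, 'e \<times> 'e) chart \<Rightarrow> 'e \<times> 'e"

text \<open>
  The vector of the \<open>G\<^sup>i\<close> in the chart \<open>c\<close>, from
  \<open>G = y\<^sup>i \<partial>/\<partial>x\<^sup>i - 2 G\<^sup>i \<partial>/\<partial>y\<^sup>i\<close>.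
\<close>

definition spray_coeff ::
    "('m, 'e::euclidean_space) chart set \<Rightarrow> ('m, 'e) tfield \<Rightarrow> ('m, 'e) chart \<Rightarrow> ('m, 'e) tvec \<Rightarrow> 'e" where
  "spray_coeff A G c \<xi> = - (1/2) *\<^sub>R snd (G \<xi> (tangent_chart A c))"

definition spray ::
    "('m, 'e::euclidean_space) chart set \<Rightarrow> ('m, 'e) tvec set \<Rightarrow> ('m, 'e) tfield \<Rightarrow> bool" where
  "spray A C G \<longleftrightarrow>
     conical_region A C \<and> smooth_vector_field (tangent_atlas A) C G \<and>
     (\<forall>c\<in>A. \<forall>\<xi>\<in>C. fst \<xi> \<in> fst c \<longrightarrow>
        fst (G \<xi> (tangent_chart A c)) = snd \<xi> c \<and>
        (\<forall>r>0. spray_coeff A G c (tscale r \<xi>) = r\<^sup>2 *\<^sub>R spray_coeff A G c \<xi>))"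

definition geodesic ::
    "('m, 'e::euclidean_space) chart set \<Rightarrow> ('m, 'e) tvec set \<Rightarrow> ('m, 'e) tfield \<Rightarrow>
     real set \<Rightarrow> (real \<Rightarrow> 'm) \<Rightarrow> bool" where
  "geodesic A C G J \<gamma> \<longleftrightarrow>
     (\<exists>\<xi>. integral_curve (tangent_atlas A) C G J \<xi> \<and> (\<forall>t\<in>J. \<gamma> t = fst (\<xi> t)))"

definition maximal_geodesic ::
    "('m, 'e::euclidean_space) chart set \<Rightarrow> ('m, 'e) tvec set \<Rightarrow> ('m, 'e) tfield \<Rightarrow>
     real set \<Rightarrow> (real \<Rightarrow> 'm) \<Rightarrow> bool" where
  "maximal_geodesic A C G J \<gamma> \<longleftrightarrow>
     geodesic A C G J \<gamma> \<and>
     (\<forall>J' \<gamma>'. geodesic A C G J' \<gamma>' \<and> J \<subseteq> J' \<and> (\<forall>t\<in>J. \<gamma>' t = \<gamma> t) \<longrightarrow> J' = J)"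

definition velocity ::
    "('m, 'e::euclidean_space) chart set \<Rightarrow> (real \<Rightarrow> 'm) \<Rightarrow> real \<Rightarrow> ('m, 'e) tvec" where
  "velocity A \<gamma> t =
     (\<gamma> t, \<lambda>c. if c \<in> A \<and> \<gamma> t \<in> fst c then vector_derivative (snd c \<circ> \<gamma>) (at t) else 0)"

definition complete_spray ::
    "('m, 'e::euclidean_space) chart set \<Rightarrow> ('m, 'e) tvec set \<Rightarrow> ('m, 'e) tfield \<Rightarrow> bool" where
  "complete_spray A C G \<longleftrightarrow>
     (\<forall>J \<gamma>. geodesic A C G J \<gamma> \<longrightarrow>
        (\<exists>\<gamma>'. geodesic A C G UNIV \<gamma>' \<and> (\<forall>t\<in>J. \<gamma>' t = \<gamma> t)))"

definition positively_complete_spray ::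
    "('m, 'e::euclidean_space) chart set \<Rightarrow> ('m, 'e) tvec set \<Rightarrow> ('m, 'e) tfield \<Rightarrow> bool" where
  "positively_complete_spray A C G \<longleftrightarrow>
     (\<forall>J \<gamma>. geodesic A C G J \<gamma> \<longrightarrow>
        (\<exists>J' \<gamma>'. geodesic A C G J' \<gamma>' \<and> J \<subseteq> J' \<and> (\<forall>t\<in>J. {t..} \<subseteq> J' \<and> \<gamma>' t = \<gamma> t)))"

definition negatively_complete_spray ::
    "('m, 'e::euclidean_space) chart set \<Rightarrow> ('m, 'e) tvec set \<Rightarrow> ('m, 'e) tfield \<Rightarrow> bool" where
  "negatively_complete_spray A C G \<longleftrightarrow>
     (\<forall>J \<gamma>. geodesic A C G J \<gamma> \<longrightarrow>
        (\<exists>J' \<gamma>'. geodesic A C G J' \<gamma>' \<and> J \<subseteq> J' \<and> (\<forall>t\<in>J. {..t} \<subseteq> J' \<and> \<gamma>' t = \<gamma> t)))"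


subsection \<open>Projective relation\<close>

text \<open>The function \<open>P\<close> is the same for all charts, being a function on \<open>C\<close>.\<close>

definition projectively_related ::
    "('m, 'e::euclidean_space) chart set \<Rightarrow> ('m, 'e) tvec set \<Rightarrow> ('m, 'e) tfield \<Rightarrow> ('m, 'e) tfield \<Rightarrow> bool" where
  "projectively_related A C G G' \<longleftrightarrow>
     (\<exists>P :: ('m, 'e) tvec \<Rightarrow> real. \<forall>c\<in>A. \<forall>\<xi>\<in>C. fst \<xi> \<in> fst c \<longrightarrow>
        spray_coeff A G' c \<xi> = spray_coeff A G c \<xi> + P \<xi> *\<^sub>R snd \<xi> c)"

definition projectively_complete ::
    "('m, 'e::euclidean_space) chart set \<Rightarrow> ('m, 'e) tvec set \<Rightarrow> ('m, 'e) tfield \<Rightarrow> bool" where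
  "projectively_complete A C G \<longleftrightarrow>
     (\<exists>G'. spray A C G' \<and> projectively_related A C G G' \<and> complete_spray A C G')"

definition projectively_positively_complete ::
    "('m, 'e::euclidean_space) chart set \<Rightarrow> ('m, 'e) tvec set \<Rightarrow> ('m, 'e) tfield \<Rightarrow> bool" where
  "projectively_positively_complete A C G \<longleftrightarrow>
     (\<exists>G'. spray A C G' \<and> projectively_related A C G G' \<and> positively_complete_spray A C G')"

definition projectively_negatively_complete ::
    "('m, 'e::euclidean_space) chart set \<Rightarrow> ('m, 'e) tvec set \<Rightarrow> ('m, 'e) tfield \<Rightarrow> bool" where
  "projectively_negatively_complete A C G \<longleftrightarrow>
     (\<exists>G'. spray A C G' \<and> projectively_related A C G G' \<and> negatively_complete_spray A C G')"

end

theory Submission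
  imports Defs
begin

text \<open>
  The idea is to change the time along the geodesics so that every lifetime becomes \<open>\<real>\<close>, by a
  change of time that is given by a function on \<open>C\<close>.

  Put \<open>\<alpha> = 1/a\<close> and \<open>\<beta> = 1/b\<close>, and 0 instead if the corresponding end is infinite. Then in all three
  cases \<open>\<alpha> \<le> 0 \<le> \<beta>\<close> and \<open>\<alpha> < \<beta>\<close>, and the maximal geodesics with initial velocity \<open>v\<close> have the
  lifetime \<open>{t. \<alpha> v * t < 1 \<and> \<beta> v * t < 1}\<close>. An affine change of time turns maximal geodesics into
  maximal geodesics, and the lifetime determines \<open>\<alpha> v\<close> and \<open>\<beta> v\<close>. Hence \<open>\<alpha> (r v) = r \<alpha> v\<close> for
  \<open>r > 0\<close>, and \<open>\<alpha>\<close> at time \<open>t\<close> of the geodesic is \<open>\<alpha> v / (1 - \<alpha> v * t)\<close>; likewise for \<open>\<beta>\<close>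
  (lemma \<open>slopes_affine\<close>). Consequently \<open>F = \<beta> - \<alpha>\<close> is positive and homogeneous of degree 1, and its
  integral along the geodesic is \<open>ln ((1 - \<alpha> v * t) / (1 - \<beta> v * t))\<close>, which maps the lifetime onto
  \<open>\<real>\<close>. The geodesics with this integral as their time, up to a constant factor, are those of the spray
  that differs from \<open>G\<close> by the multiple \<open>- G(F)/F\<close> of the Liouville field \<open>y\<^sup>i \<partial>/\<partial>y\<^sup>i\<close>. Since \<open>\<alpha>\<close> and
  \<open>\<beta>\<close> have the derivatives \<open>\<alpha>\<^sup>2\<close> and \<open>\<beta>\<^sup>2\<close> along \<open>G\<close>, the multiple is \<open>- (\<alpha> + \<beta>)\<close>, so the projective
  factor is \<open>P = (\<alpha> + \<beta>)/2\<close>: it is smooth and homogeneous, and the result is a spray.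

  To see that this spray is complete, take one of its geodesics, on any interval \<open>J\<close>. Along it both
  \<open>\<alpha>\<close> and \<open>\<beta>\<close> have the derivative \<open>- \<alpha> \<beta>\<close> (lemma \<open>slopes_along_completed_spray\<close>), so they are known
  explicitly, and the change of time can be undone explicitly. This gives a geodesic of \<open>G\<close> on a part
  of a lifetime. It extends to a maximal geodesic, which is defined on the whole lifetime by
  hypothesis, and the change of time carries the extension to a geodesic of the new spray on \<open>\<real>\<close>
  (lemma \<open>complete_completed_spray\<close>).

  What this uses about differential equations is local existence, by the fixed point of Picard's
  operator, and Zorn's lemma to pass to maximal geodesics. A complete spray is both positively and
  negatively complete, so the same spray serves all three conclusions in each of the cases.
\<close>



section \<open>Calculus of continuously differentiable maps\<close>

lemma has_derivative_cong_open:
  assumes "open S" "x \<in> S" "\<And>y. y \<in> S \<Longrightarrow> f y = g y" "f differentiable (at x)"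
  shows "(g has_derivative frechet_derivative f (at x)) (at x)"
  using assms has_derivative_transform_within_open[of f "frechet_derivative f (at x)" x UNIV S g]
  by (auto simp: frechet_derivative_works)

lemma ck_on_cong:
  assumes "open S"
  shows "ck_on k S f \<Longrightarrow> (\<And>x. x \<in> S \<Longrightarrow> f x = g x) \<Longrightarrow> ck_on k S g"
proof (induction k arbitrary: f g)
  case 0
  then show ?case
    using continuous_on_cong[of S S f g] by simp
next
  case (Suc k)
  have D: "(g has_derivative frechet_derivative f (at x)) (at x)" if "x \<in> S" for x
    using has_derivative_cong_open[OF assms that, of f g] Suc.prems that by auto
  have eq: "frechet_derivative f (at x) h = frechet_derivative g (at x) h" if "x \<in> S" for x h
    using frechet_derivative_at[OF D[OF that]] by simp
  have "ck_on k S (\<lambda>x. frechet_derivative g (at x) h)" for h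
    by (rule Suc.IH[of "\<lambda>x. frechet_derivative f (at x) h"]) (use Suc.prems eq in auto)
  then show ?case
    using D by (auto simp: differentiable_def)
qed

lemma ck_on_SucI:
  assumes "open S" "\<And>x. x \<in> S \<Longrightarrow> (f has_derivative D x) (at x)" "\<And>h. ck_on k S (\<lambda>x. D x h)"
  shows "ck_on (Suc k) S f"
proof -
  have "D x h = frechet_derivative f (at x) h" if "x \<in> S" for x h
    using frechet_derivative_at[OF assms(2)[OF that]] by simp
  then have "ck_on k S (\<lambda>x. frechet_derivative f (at x) h)" for h
    using ck_on_cong[OF assms(1) assms(3)[of h], of "\<lambda>x. frechet_derivative f (at x) h"] by blast
  then show ?thesis
    using assms(2) by (auto simp: differentiable_def)
qed

lemma ck_on_Suc_derivative:
  assumes "ck_on (Suc k) S f" "x \<in> S"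
  shows "(f has_derivative frechet_derivative f (at x)) (at x)"
  using assms by (simp flip: frechet_derivative_works)

lemma ck_on_Suc_imp: "ck_on (Suc k) S f \<Longrightarrow> ck_on k S f"
proof (induction k arbitrary: f)
  case 0
  then show ?case
    by (auto intro!: continuous_at_imp_continuous_on differentiable_imp_continuous_within)
next
  case (Suc k)
  show ?case
    unfolding ck_on.simps(2)[of k] using Suc.prems Suc.IH by simp
qed

lemma ck_on_const: "ck_on k S (\<lambda>_. c)"
  by (induction k arbitrary: c) (auto simp: frechet_derivative_const)

lemma ck_on_bounded_linear:
  assumes "bounded_linear L" "open S"
  shows "ck_on k S L"
proof (cases k)
  case 0
  then show ?thesis
    using assms by (simp add: linear_continuous_on)
next
  case (Suc n)
  show ?thesis
    unfolding Suc
    by (rule ck_on_SucI[OF assms(2), of _ "\<lambda>_. L"])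
      (auto intro: ck_on_const bounded_linear_imp_has_derivative assms)
qed

lemma ck_on_add:
  assumes "open S"
  shows "ck_on k S f \<Longrightarrow> ck_on k S g \<Longrightarrow> ck_on k S (\<lambda>x. f x + g x)"
proof (induction k arbitrary: f g)
  case 0
  then show ?case by (simp add: continuous_on_add)
next
  case (Suc k)
  show ?case
  proof (rule ck_on_SucI[OF assms])
    fix x assume "x \<in> S"
    then show "((\<lambda>x. f x + g x) has_derivative
        (\<lambda>h. frechet_derivative f (at x) h + frechet_derivative g (at x) h)) (at x)"
      by (intro has_derivative_add ck_on_Suc_derivative[OF Suc.prems(1)]
          ck_on_Suc_derivative[OF Suc.prems(2)])
  qed (use Suc in simp)
qed

lemma ck_on_scaleR:
  fixes f :: "'a::real_normed_vector \<Rightarrow> real"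
  assumes "open S"
  shows "ck_on k S f \<Longrightarrow> ck_on k S g \<Longrightarrow> ck_on k S (\<lambda>x. f x *\<^sub>R g x)"
proof (induction k arbitrary: f g)
  case 0
  then show ?case by (simp add: continuous_on_scaleR)
next
  case (Suc k)
  show ?case
  proof (rule ck_on_SucI[OF assms])
    fix x assume "x \<in> S"
    then show "((\<lambda>x. f x *\<^sub>R g x) has_derivative
        (\<lambda>h. f x *\<^sub>R frechet_derivative g (at x) h + frechet_derivative f (at x) h *\<^sub>R g x)) (at x)"
      by (intro has_derivative_scaleR ck_on_Suc_derivative[OF Suc.prems(1)]
          ck_on_Suc_derivative[OF Suc.prems(2)])
  next
    fix h
    have "ck_on k S f" "ck_on k S g"
      using Suc.prems by (blast intro: ck_on_Suc_imp)+
    then show "ck_on k S (\<lambda>x. f x *\<^sub>R frechet_derivative g (at x) h +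
        frechet_derivative f (at x) h *\<^sub>R g x)"
      using Suc by (intro ck_on_add assms Suc.IH) simp_all
  qed
qed

text \<open>
  The derivative of \<open>1/f\<close> is \<open>- f'\<close> times the square of \<open>1/f\<close>, so the induction hypothesis for \<open>1/f\<close>
  together with the product rule \<open>ck_on_scaleR\<close> gives the step.
\<close>

lemma ck_on_inverse:
  fixes f :: "'a::real_normed_vector \<Rightarrow> real"
  assumes "open S" "\<And>x. x \<in> S \<Longrightarrow> f x \<noteq> 0"
  shows "ck_on k S f \<Longrightarrow> ck_on k S (\<lambda>x. inverse (f x))"
proof (induction k)
  case 0
  then show ?case using assms by (auto intro: continuous_on_inverse)
next
  case (Suc k)
  show ?case
  proof (rule ck_on_SucI[OF assms(1)])
    fix x assume x: "x \<in> S"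
    have "((\<lambda>x. inverse (f x)) has_derivative
        (\<lambda>h. - (inverse (f x) * frechet_derivative f (at x) h * inverse (f x)))) (at x)"
      by (rule Deriv.has_derivative_inverse[OF assms(2)[OF x] ck_on_Suc_derivative[OF Suc.prems x]])
    then show "((\<lambda>x. inverse (f x)) has_derivative
        (\<lambda>h. (inverse (f x) *\<^sub>R inverse (f x)) *\<^sub>R (- 1) *\<^sub>R frechet_derivative f (at x) h)) (at x)"
      by (simp add: algebra_simps)
  next
    fix h
    have i: "ck_on k S (\<lambda>x. inverse (f x))"
      using Suc.IH Suc.prems ck_on_Suc_imp by blast
    then show "ck_on k S (\<lambda>x. (inverse (f x) *\<^sub>R inverse (f x)) *\<^sub>R (- 1) *\<^sub>R frechet_derivative f (at x) h)"
      using Suc.prems by (intro ck_on_scaleR assms(1) ck_on_const) simp_all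
  qed
qed


section \<open>Existence and uniqueness for ordinary differential equations\<close>

text \<open>
  Continuity of the derivative is only known in each fixed direction. A bound in each basis direction
  still bounds its operator norm, because the dimension is finite.
\<close>

lemma C1_lipschitz_on_compact_convex:
  fixes f :: "'a::euclidean_space \<Rightarrow> 'b::real_normed_vector"
  assumes "ck_on 1 U f" "K \<subseteq> U" "compact K" "convex K"
  obtains L where "L \<ge> 0" "\<And>x y. x \<in> K \<Longrightarrow> y \<in> K \<Longrightarrow> norm (f x - f y) \<le> L * norm (x - y)"
proof -
  have D: "(f has_derivative frechet_derivative f (at x)) (at x)" if "x \<in> K" for x
    using assms that by (auto simp flip: frechet_derivative_works)
  have "\<exists>B. \<forall>x\<in>K. norm (frechet_derivative f (at x) i) \<le> B" for i
  proof -
    have "continuous_on K (\<lambda>x. frechet_derivative f (at x) i)"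
      using assms by (auto intro: continuous_on_subset[of U])
    then have "bounded ((\<lambda>x. frechet_derivative f (at x) i) ` K)"
      using assms compact_continuous_image compact_imp_bounded by blast
    then show ?thesis
      by (auto simp: bounded_iff)
  qed
  then obtain B where B: "\<And>i x. x \<in> K \<Longrightarrow> norm (frechet_derivative f (at x) i) \<le> B i"
    by metis
  define L where "L = (\<Sum>i\<in>Basis. \<bar>B i\<bar>)"
  have "norm (frechet_derivative f (at x) h) \<le> L * norm h" if "x \<in> K" for x h
  proof -
    have lin: "linear (frechet_derivative f (at x))"
      using D[OF that] has_derivative_linear by blast
    have "frechet_derivative f (at x) h = frechet_derivative f (at x) (\<Sum>i\<in>Basis. (h \<bullet> i) *\<^sub>R i)"
      by (simp add: euclidean_representation)
    also have "\<dots> = (\<Sum>i\<in>Basis. (h \<bullet> i) *\<^sub>R frechet_derivative f (at x) i)"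
      by (simp add: linear_sum[OF lin] linear_scale[OF lin])
    also have "norm \<dots> \<le> (\<Sum>i\<in>Basis. norm h * \<bar>B i\<bar>)"
      using B[OF that] by (intro sum_norm_le) (auto intro!: mult_mono Basis_le_norm intro: order_trans[OF _ abs_ge_self])
    finally show ?thesis
      by (simp add: L_def sum_distrib_left mult.commute)
  qed
  then have "onorm (frechet_derivative f (at x)) \<le> L" if "x \<in> K" for x
    using that by (intro onorm_le) auto
  then have "norm (f x - f y) \<le> L * norm (x - y)" if "x \<in> K" "y \<in> K" for x y
    using that by (intro differentiable_bound[OF assms(4), of f "\<lambda>x. frechet_derivative f (at x)"])
      (auto intro: has_derivative_at_withinI D)
  moreover have "L \<ge> 0"
    by (simp add: L_def sum_nonneg)
  ultimately show thesis
    using that by blast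
qed

text \<open>
  Picard's operator is applied to bounded continuous functions on the whole line, which form a complete
  metric space: the time is cut off to \<open>[-e, e]\<close>. Integrals start at \<open>-e\<close>, and the value at 0 is
  corrected afterwards, so that both signs of the time are treated alike. The two integrals make the
  operator a contraction with factor \<open>4 * e * L\<close>.
\<close>

lemma lipschitz_ode_solution:
  fixes f :: "'a::euclidean_space \<Rightarrow> 'a"
  assumes "L \<ge> 0" and lip: "\<And>x y. norm (f x - f y) \<le> L * norm (x - y)"
    and e: "e > 0" "4 * e * L \<le> 1 / 2"
  obtains x :: "real \<Rightarrow> 'a" where "x 0 = p" "\<And>t. \<bar>t\<bar> < e \<Longrightarrow> (x has_vector_derivative f (x t)) (at t)"
proof -
  have cf: "continuous_on S f" for S
  proof -
    have "L-lipschitz_on S f"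
      using assms by (auto simp: lipschitz_on_def dist_norm)
    then show ?thesis
      by (rule lipschitz_on_continuous_on)
  qed
  define cl where "cl t = max (- e) (min e t)" for t :: real
  have cl: "cl t \<in> {-e..e}" for t
    using e by (auto simp: cl_def)
  define T where "T u t = p + integral {-e..cl t} (\<lambda>s. f (u s)) - integral {-e..0} (\<lambda>s. f (u s))"
    for u :: "real \<Rightarrow> 'a" and t
  have cont: "continuous_on {-e..e} (\<lambda>s. f (apply_bcontfun u s))" for u :: "real \<Rightarrow>\<^sub>C 'a"
    by (intro continuous_on_compose2[OF cf[of UNIV]]) auto
  have int: "(\<lambda>s. f (apply_bcontfun u s)) integrable_on {-e..t}" if "t \<le> e" for u :: "real \<Rightarrow>\<^sub>C 'a" and t
    using that by (intro integrable_continuous_real continuous_on_subset[OF cont]) auto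
  have bc: "T (apply_bcontfun u) \<in> bcontfun" for u :: "real \<Rightarrow>\<^sub>C 'a"
  proof -
    have i: "continuous_on {-e..e} (\<lambda>t. integral {-e..t} (\<lambda>s. f (apply_bcontfun u s)))"
      by (rule indefinite_integral_continuous_1[OF int]) simp
    have "continuous_on UNIV (T (apply_bcontfun u))"
      unfolding T_def
      by (intro continuous_intros continuous_on_compose2[OF i])
        (use cl in \<open>auto simp: cl_def intro!: continuous_intros\<close>)
    moreover have "bounded (range (T (apply_bcontfun u)))"
    proof -
      have "bounded ((\<lambda>t. integral {-e..t} (\<lambda>s. f (apply_bcontfun u s))) ` {-e..e})"
        by (intro compact_imp_bounded compact_continuous_image i) simp
      then obtain B where "\<And>t. t \<in> {-e..e} \<Longrightarrow> norm (integral {-e..t} (\<lambda>s. f (apply_bcontfun u s))) \<le> B"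
        unfolding bounded_iff ball_simps by blast
      note B = this[OF cl]
      have "norm (T (apply_bcontfun u) t) \<le>
          norm p + B + norm (integral {-e..0} (\<lambda>s. f (apply_bcontfun u s)))" for t
        unfolding T_def using B[of t]
        by (meson add_mono norm_triangle_ineq norm_triangle_ineq4 order_refl order_trans)
      then show ?thesis
        by (auto simp: bounded_iff)
    qed
    ultimately show ?thesis
      by (simp add: bcontfun_def)
  qed
  define T' where "T' u = Bcontfun (T (apply_bcontfun u))" for u :: "real \<Rightarrow>\<^sub>C 'a"
  have T': "apply_bcontfun (T' u) = T (apply_bcontfun u)" for u
    unfolding T'_def by (rule Bcontfun_inverse[OF bc])
  have contr: "dist (T' u) (T' v) \<le> (1/2) * dist u v" for u v
  proof (rule dist_bound)
    fix t
    have part: "norm (integral {-e..r} (\<lambda>s. f (u s)) - integral {-e..r} (\<lambda>s. f (v s))) \<le>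
        2 * e * L * dist u v" if r: "r \<in> {-e..e}" for r
    proof -
      have "integral {-e..r} (\<lambda>s. f (u s)) - integral {-e..r} (\<lambda>s. f (v s)) =
          integral {-e..r} (\<lambda>s. f (u s) - f (v s))"
        using int[of r] r by (subst integral_diff) auto
      also have "norm \<dots> \<le> (L * dist u v) * (r - (- e))"
      proof (rule integral_bound)
        show "continuous_on {-e..r} (\<lambda>s. f (u s) - f (v s))"
          using r by (intro continuous_on_diff continuous_on_subset[OF cont]) auto
        fix s
        have "norm (f (u s) - f (v s)) \<le> L * dist (u s) (v s)"
          using lip by (simp add: dist_norm)
        also have "\<dots> \<le> L * dist u v"
          using \<open>L \<ge> 0\<close> by (intro mult_left_mono dist_bounded)
        finally show "norm (f (u s) - f (v s)) \<le> L * dist u v" .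
      qed (use r in auto)
      also have "\<dots> \<le> (L * dist u v) * (2 * e)"
        using r \<open>L \<ge> 0\<close> by (intro mult_left_mono) auto
      finally show ?thesis
        by (simp add: mult_ac)
    qed
    have "dist (T' u t) (T' v t) =
        norm ((integral {-e..cl t} (\<lambda>s. f (u s)) - integral {-e..cl t} (\<lambda>s. f (v s))) -
              (integral {-e..0} (\<lambda>s. f (u s)) - integral {-e..0} (\<lambda>s. f (v s))))"
      unfolding T' T_def dist_norm by (rule arg_cong[of _ _ norm]) (simp add: algebra_simps)
    also have "\<dots> \<le> 2 * e * L * dist u v + 2 * e * L * dist u v"
      using e by (intro order_trans[OF norm_triangle_ineq4] add_mono part cl) auto
    also have "\<dots> = (4 * e * L) * dist u v"
      by simp
    also have "\<dots> \<le> (1/2) * dist u v"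
      using e by (intro mult_right_mono) auto
    finally show "dist (T' u t) (T' v t) \<le> (1/2) * dist u v" .
  qed
  obtain u where u: "T' u = u"
    using banach_fix_type[of "1/2" T'] contr by auto
  define x where "x = apply_bcontfun u"
  have x: "x t = T x t" for t
    using T'[of u] u by (simp add: x_def fun_eq_iff)
  show thesis
  proof
    show "x 0 = p"
      using e by (subst x) (simp add: T_def cl_def)
  next
    fix t :: real assume t: "\<bar>t\<bar> < e"
    have "((\<lambda>r. integral {-e..r} (\<lambda>s. f (x s))) has_vector_derivative f (x t)) (at t within {-e..e})"
      using t cont[of u] by (intro integral_has_vector_derivative) (auto simp: x_def)
    then have "((\<lambda>r. integral {-e..r} (\<lambda>s. f (x s))) has_vector_derivative f (x t)) (at t)"
      using t by (subst (asm) at_within_interior) auto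
    then have "((\<lambda>r. p + integral {-e..r} (\<lambda>s. f (x s)) - integral {-e..0} (\<lambda>s. f (x s)))
        has_vector_derivative f (x t)) (at t)"
      by (auto intro!: derivative_eq_intros)
    then show "(x has_vector_derivative f (x t)) (at t)"
    proof (rule has_vector_derivative_transform_within_open[of _ _ _ "{-e<..<e}"])
      show "p + integral {-e..r} (\<lambda>s. f (x s)) - integral {-e..0} (\<lambda>s. f (x s)) = x r"
        if "r \<in> {-e<..<e}" for r
        using that by (subst (3) x) (simp add: T_def cl_def)
    qed (use t in auto)
  qed
qed

text \<open>
  Precomposing with the nearest point projection onto a closed ball makes the right-hand side globally
  Lipschitz; a solution that starts at the centre stays in the ball for a short time, where the
  projection is the identity.
\<close>

lemma C1_ode_solution:
  fixes f :: "'a::euclidean_space \<Rightarrow> 'a"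
  assumes "open U" "p \<in> U" "ck_on 1 U f"
  obtains e x where "e > 0" "x 0 = p"
    "\<And>t. \<bar>t\<bar> < e \<Longrightarrow> x t \<in> U \<and> (x has_vector_derivative f (x t)) (at t)"
proof -
  obtain r where r: "r > 0" "cball p r \<subseteq> U"
    using assms open_contains_cball by blast
  obtain L where L: "L \<ge> 0" "\<And>x y. x \<in> cball p r \<Longrightarrow> y \<in> cball p r \<Longrightarrow> norm (f x - f y) \<le> L * norm (x - y)"
    using C1_lipschitz_on_compact_convex[OF assms(3) r(2)] by auto
  let ?c = "closest_point (cball p r)"
  have c_in: "?c x \<in> cball p r" for x
    using r by (intro closest_point_in_set) auto
  have lip: "norm (f (?c x) - f (?c y)) \<le> L * norm (x - y)" for x y
  proof -
    have "norm (f (?c x) - f (?c y)) \<le> L * norm (?c x - ?c y)"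
      using L c_in by blast
    also have "\<dots> \<le> L * norm (x - y)"
      using closest_point_lipschitz[of "cball p r" x y] r L
      by (intro mult_left_mono) (auto simp: dist_norm)
    finally show ?thesis .
  qed
  \<comment> \<open>Any \<open>e\<close> with \<open>8 * e * L \<le> 1\<close> would do; adding 1 covers the case \<open>L = 0\<close>.\<close>
  define e where "e = 1 / (8 * (L + 1))"
  have e: "e > 0" "4 * e * L \<le> 1 / 2"
    using L by (auto simp: e_def field_simps)
  obtain x where x: "x 0 = p" "\<And>t. \<bar>t\<bar> < e \<Longrightarrow> (x has_vector_derivative f (?c (x t))) (at t)"
    using lipschitz_ode_solution[of L "\<lambda>x. f (?c x)", OF L(1) lip e] by metis
  have "continuous (at 0) x"
    using x(2)[of 0] e has_vector_derivative_continuous by auto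
  then obtain d where d: "d > 0" "\<And>t. \<bar>t\<bar> < d \<Longrightarrow> dist (x t) p < r"
    using r x(1) by (auto simp: continuous_at_eps_delta dist_real_def)
  show thesis
  proof
    show "min d e > 0" "x 0 = p"
      using d e x by auto
    fix t :: real assume t: "\<bar>t\<bar> < min d e"
    then have "x t \<in> cball p r"
      using d by (auto simp: dist_commute less_imp_le)
    then show "x t \<in> U \<and> (x has_vector_derivative f (x t)) (at t)"
      using x(2)[of t] t r closest_point_self[of "x t" "cball p r"] by auto
  qed
qed

text \<open>
  The integrating factor \<open>exp (- M)\<close>, for an antiderivative \<open>M\<close> of \<open>m\<close> on the segment between \<open>s0\<close>
  and \<open>s\<close>, makes \<open>\<delta>\<close> constant there.
\<close>

lemma linear_ode_zero:
  fixes \<delta> m :: "real \<Rightarrow> real"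
  assumes J: "is_interval J" "s0 \<in> J" "s \<in> J"
    and der: "\<And>s. s \<in> J \<Longrightarrow> (\<delta> has_real_derivative m s * \<delta> s) (at s)"
    and m: "continuous_on J m" and "\<delta> s0 = 0"
  shows "\<delta> s = 0"
proof -
  define K where "K = {min s s0..max s s0}"
  have mem: "x \<in> J" if "a \<in> J" "b \<in> J" "a \<le> x \<and> x \<le> b" for a b x
    using J(1) that unfolding is_interval_1 by blast
  have KJ: "K \<subseteq> J"
    using mem[OF J(2,3)] mem[OF J(3,2)] by (cases "s \<le> s0") (auto simp: K_def)
  obtain M where M: "\<And>x. x \<in> K \<Longrightarrow> (M has_vector_derivative m x) (at x within K)"
    using antiderivative_continuous[of "min s s0" "max s s0" m] continuous_on_subset[OF m KJ]
    unfolding K_def by metis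
  have "((\<lambda>x. \<delta> x * exp (- M x)) has_field_derivative 0) (at x within K)" if "x \<in> K" for x
  proof -
    have "(\<delta> has_field_derivative m x * \<delta> x) (at x within K)"
      using der KJ that by (blast intro: has_field_derivative_at_within)
    moreover have "(M has_field_derivative m x) (at x within K)"
      using M[OF that] by (simp add: has_real_derivative_iff_has_vector_derivative)
    ultimately show ?thesis
      by (auto intro!: derivative_eq_intros)
  qed
  then obtain c where "\<And>x. x \<in> K \<Longrightarrow> \<delta> x * exp (- M x) = c"
    using has_field_derivative_zero_constant[of K "\<lambda>x. \<delta> x * exp (- M x)"]
    unfolding K_def by (metis convex_real_interval(5))
  from this[of s] this[of s0] show ?thesis
    using \<open>\<delta> s0 = 0\<close> by (auto simp: K_def)
qed


section \<open>Integral curves in coordinates\<close>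

text \<open>
  Integral curves depend on the charts to first order only. This notion passes from an atlas to its
  tangent atlas by one differentiation of the transition maps, which for smoothness would have to be
  repeated at every order.
\<close>

definition differentiable_atlas :: "('m, 'e::euclidean_space) chart set \<Rightarrow> bool" where
  "differentiable_atlas A \<longleftrightarrow>
     (\<forall>c\<in>A. inj_on (snd c) (fst c)) \<and>
     (\<forall>c\<in>A. \<forall>d\<in>A. open (snd c ` (fst c \<inter> fst d)) \<and>
        (\<forall>x\<in>snd c ` (fst c \<inter> fst d). transition c d differentiable (at x)))"

lemma differentiable_atlas_inj: "differentiable_atlas A \<Longrightarrow> c \<in> A \<Longrightarrow> inj_on (snd c) (fst c)"
  by (simp add: differentiable_atlas_def)

lemma differentiable_atlas_transition:
  assumes "differentiable_atlas A" "c \<in> A" "d \<in> A" "p \<in> fst c" "p \<in> fst d"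
  shows "(transition c d has_derivative frechet_derivative (transition c d) (at (snd c p))) (at (snd c p))"
  using assms unfolding differentiable_atlas_def frechet_derivative_works[symmetric] by auto

lemma smooth_imp_differentiable_atlas:
  assumes "smooth_atlas A"
  shows "differentiable_atlas A"
proof -
  have "ck_on 1 (snd c ` (fst c \<inter> fst d)) (transition c d)" if "c \<in> A" "d \<in> A" for c d
    using assms that unfolding smooth_atlas_def smooth_on_def by blast
  with assms show ?thesis
    unfolding differentiable_atlas_def smooth_atlas_def by simp
qed

lemma chart_inv_chart: "inj_on (snd c) (fst c) \<Longrightarrow> p \<in> fst c \<Longrightarrow> chart_inv c (snd c p) = p"
  by (simp add: chart_inv_def)

lemma transition_chart:
  "inj_on (snd c) (fst c) \<Longrightarrow> p \<in> fst c \<Longrightarrow> transition c d (snd c p) = snd d p"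
  by (simp add: transition_def chart_inv_chart)

lemma openin_differentiable_atlas:
  "differentiable_atlas A \<Longrightarrow> openin (atlas_topology A) W \<longleftrightarrow>
     W \<subseteq> manifold_points A \<and> (\<forall>c\<in>A. open (snd c ` (fst c \<inter> W)))"
  by (rule openin_atlas_topology) (simp add: differentiable_atlas_inj)

lemma openin_chart_domain: "differentiable_atlas A \<Longrightarrow> c \<in> A \<Longrightarrow> openin (atlas_topology A) (fst c)"
  by (auto simp: openin_differentiable_atlas manifold_points_def differentiable_atlas_def)

lemma tangent_bundle_transform:
  assumes "(p, v) \<in> tangent_bundle A" "c \<in> A" "d \<in> A" "p \<in> fst c" "p \<in> fst d"
  shows "v d = frechet_derivative (transition c d) (at (snd c p)) (v c)"
proof -
  have "\<forall>c\<in>A. \<forall>d\<in>A. p \<in> fst c \<inter> fst d \<longrightarrow>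
      v d = frechet_derivative (transition c d) (at (snd c p)) (v c)"
    using assms(1) unfolding tangent_bundle_def mem_Collect_eq prod.case by (elim conjE)
  from this[THEN bspec, OF assms(2), THEN bspec, OF assms(3), THEN mp, OF IntI, OF assms(4,5)]
  show ?thesis .
qed

lemma isCont_nbhd:
  assumes "isCont f t" "open S" "f t \<in> S" "open N" "t \<in> N"
  obtains N' where "open N'" "t \<in> N'" "N' \<subseteq> N" "\<And>s. s \<in> N' \<Longrightarrow> f s \<in> S"
proof -
  have "(f \<longlongrightarrow> f t) (nhds t)"
    using assms(1) by (simp add: isCont_def tendsto_at_iff_tendsto_nhds)
  then have "eventually (\<lambda>s. f s \<in> S) (nhds t)"
    using assms topological_tendstoD by blast
  then obtain N0 where "open N0" "t \<in> N0" "\<forall>s\<in>N0. f s \<in> S"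
    by (auto simp: eventually_nhds)
  then show thesis
    using assms by (intro that[of "N0 \<inter> N"]) auto
qed

text \<open>
  If a curve is continuous in one chart, then it is continuous for the topology of the atlas. The curve
  has to be known to stay in the chart near \<open>t\<close>, since coordinates carry no information elsewhere.
\<close>

lemma chart_change_nbhd:
  assumes A: "differentiable_atlas A" "c \<in> A" "openin (atlas_topology A) W"
    and N: "open N" "t \<in> N" "\<And>s. s \<in> N \<Longrightarrow> \<gamma> s \<in> fst c"
    and "isCont (snd c \<circ> \<gamma>) t" "\<gamma> t \<in> W"
  obtains N' where "open N'" "t \<in> N'" "N' \<subseteq> N" "\<And>s. s \<in> N' \<Longrightarrow> \<gamma> s \<in> W"
proof -
  have "open (snd c ` (fst c \<inter> W))"
    using A by (simp add: openin_differentiable_atlas)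
  moreover have "(snd c \<circ> \<gamma>) t \<in> snd c ` (fst c \<inter> W)"
    using assms by auto
  ultimately obtain N' where N': "open N'" "t \<in> N'" "N' \<subseteq> N"
      "\<And>s. s \<in> N' \<Longrightarrow> (snd c \<circ> \<gamma>) s \<in> snd c ` (fst c \<inter> W)"
    using isCont_nbhd[OF assms(7) _ _ N(1,2)] by metis
  have "\<gamma> s \<in> W" if s: "s \<in> N'" for s
  proof -
    obtain q where q: "q \<in> fst c" "q \<in> W" "snd c (\<gamma> s) = snd c q"
      using N'(4)[OF s] by auto
    have "\<gamma> s = q"
      using inj_onD[OF differentiable_atlas_inj[OF A(1,2)] q(3)] N(3) N'(3) s q(1) by blast
    with q show ?thesis by simp
  qed
  with N' show thesis
    using that by blast
qed

lemma chart_change_derivative: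
  assumes A: "differentiable_atlas A" "c \<in> A" "d \<in> A"
    and N: "open N" "t \<in> N" "\<And>s. s \<in> N \<Longrightarrow> \<gamma> s \<in> fst c"
    and der: "((snd c \<circ> \<gamma>) has_vector_derivative y) (at t)" and "\<gamma> t \<in> fst d"
  shows "((snd d \<circ> \<gamma>) has_vector_derivative
           frechet_derivative (transition c d) (at (snd c (\<gamma> t))) y) (at t)"
proof -
  have "(transition c d has_derivative frechet_derivative (transition c d) (at (snd c (\<gamma> t))))
      (at ((snd c \<circ> \<gamma>) t))"
    using differentiable_atlas_transition[OF A] assms by simp
  from has_derivative_at_withinI[OF this] have "((transition c d \<circ> (snd c \<circ> \<gamma>)) has_vector_derivative
      frechet_derivative (transition c d) (at (snd c (\<gamma> t))) y) (at t)"
    by (rule vector_derivative_diff_chain_within[OF der])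
  then show ?thesis
    by (rule has_vector_derivative_transform_within_open[OF _ N(1,2)])
      (simp add: transition_chart[OF differentiable_atlas_inj[OF A(1,2)] N(3)])
qed

text \<open>
  It is enough to test the equation near each time in one chart. The transformation law of the vector
  field gives it in the other charts, and differentiability gives continuity.
\<close>

lemma integral_curveI:
  assumes A: "differentiable_atlas A" and X: "\<And>p. p \<in> W \<Longrightarrow> (p, X p) \<in> tangent_bundle A"
    and J: "open J" "is_interval J" "J \<noteq> {}" "\<gamma> ` J \<subseteq> W"
    and local: "\<And>t. t \<in> J \<Longrightarrow> \<exists>c\<in>A. \<exists>N. open N \<and> t \<in> N \<and>
      (\<forall>s\<in>N. \<gamma> s \<in> fst c \<and> ((snd c \<circ> \<gamma>) has_vector_derivative X (\<gamma> s) c) (at s))"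
  shows "integral_curve A W X J \<gamma>"
  unfolding integral_curve_def
proof (intro conjI J ballI impI)
  have "openin (top_of_set J) {t \<in> J. \<gamma> t \<in> U}" if U: "openin (atlas_topology A) U" for U
  proof -
    have "\<exists>N. open N \<and> t \<in> N \<and> N \<subseteq> {t \<in> J. \<gamma> t \<in> U}" if t: "t \<in> {t \<in> J. \<gamma> t \<in> U}" for t
    proof -
      obtain c N where c: "c \<in> A" "open N" "t \<in> N" and N: "\<And>s. s \<in> N \<Longrightarrow> \<gamma> s \<in> fst c \<and>
          ((snd c \<circ> \<gamma>) has_vector_derivative X (\<gamma> s) c) (at s)"
        using local[of t] t by blast
      have "isCont (snd c \<circ> \<gamma>) t"
        using N[of t] c has_vector_derivative_continuous by blast
      then obtain N' where "open N'" "t \<in> N'" "N' \<subseteq> N" "\<And>s. s \<in> N' \<Longrightarrow> \<gamma> s \<in> U"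
        using chart_change_nbhd[OF A c(1) U c(2,3)] N t by blast
      then show ?thesis
        using t J(1) by (intro exI[of _ "N' \<inter> J"]) auto
    qed
    then have "open {t \<in> J. \<gamma> t \<in> U}"
      by (subst open_subopen) blast
    then show ?thesis
      using openin_open_eq[OF J(1)] by auto
  qed
  moreover have "\<gamma> t \<in> topspace (atlas_topology A)" if t: "t \<in> J" for t
  proof -
    obtain c where "c \<in> A" "\<gamma> t \<in> fst c"
      using local[OF t] by blast
    then show ?thesis
      using openin_subset[OF openin_chart_domain[OF A]] by blast
  qed
  ultimately show "continuous_map (top_of_set J) (atlas_topology A) \<gamma>"
    by (auto simp: continuous_map_def)
next
  fix t d assume t: "t \<in> J" and d: "d \<in> A" "\<gamma> t \<in> fst d"
  obtain c N where c: "c \<in> A" "open N" "t \<in> N" and N: "\<And>s. s \<in> N \<Longrightarrow> \<gamma> s \<in> fst c \<and>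
      ((snd c \<circ> \<gamma>) has_vector_derivative X (\<gamma> s) c) (at s)"
    using local[OF t] by blast
  have mem: "(\<gamma> t, X (\<gamma> t)) \<in> tangent_bundle A" "\<gamma> t \<in> fst c"
    using X J(4) t N c by blast+
  have "((snd d \<circ> \<gamma>) has_vector_derivative
      frechet_derivative (transition c d) (at (snd c (\<gamma> t))) (X (\<gamma> t) c)) (at t)"
    by (rule chart_change_derivative[OF A c(1) d(1) c(2,3)]) (use N c(3) d(2) in auto)
  then show "((snd d \<circ> \<gamma>) has_vector_derivative X (\<gamma> t) d) (at t)"
    unfolding tangent_bundle_transform[OF mem(1) c(1) d(1) mem(2) d(2)] .
qed

lemma integral_curve_chart:
  assumes A: "differentiable_atlas A" and \<gamma>: "integral_curve A W X J \<gamma>"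
    and t: "t \<in> J" "c \<in> A" "\<gamma> t \<in> fst c"
  obtains N where "open N" "t \<in> N" "N \<subseteq> J" "\<And>s. s \<in> N \<Longrightarrow> \<gamma> s \<in> fst c"
    "\<And>s. s \<in> N \<Longrightarrow> ((snd c \<circ> \<gamma>) has_vector_derivative X (\<gamma> s) c) (at s)"
proof -
  define N where "N = {s \<in> J. \<gamma> s \<in> fst c}"
  have "openin (top_of_set J) N"
    using \<gamma> openin_chart_domain[OF A t(2)]
    by (auto simp: integral_curve_def continuous_map_def N_def)
  then have "open N"
    using \<gamma> openin_open_eq by (auto simp: integral_curve_def)
  then show thesis
    using t \<gamma> by (intro that[of N]) (auto simp: N_def integral_curve_def)
qed

lemma integral_curve_at:
  assumes "integral_curve A W X J \<gamma>" "t \<in> J"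
  shows "\<gamma> t \<in> W" "c \<in> A \<Longrightarrow> \<gamma> t \<in> fst c \<Longrightarrow> ((snd c \<circ> \<gamma>) has_vector_derivative X (\<gamma> t) c) (at t)"
  using assms by (auto simp: integral_curve_def)

text \<open>
  Being an integral curve is a local property; this is how curves are glued.
\<close>

lemma integral_curve_cong:
  assumes A: "differentiable_atlas A" and X: "\<And>p. p \<in> W \<Longrightarrow> (p, X p) \<in> tangent_bundle A"
    and J: "open J" "is_interval J" "J \<noteq> {}"
    and local: "\<And>t. t \<in> J \<Longrightarrow> \<exists>J0 \<delta>. t \<in> J0 \<and> integral_curve A W X J0 \<delta> \<and> (\<forall>s\<in>J0. \<gamma> s = \<delta> s)"
  shows "integral_curve A W X J \<gamma>"
proof (rule integral_curveI[OF A X J])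
  show "\<gamma> ` J \<subseteq> W"
  proof
    fix p assume "p \<in> \<gamma> ` J"
    then obtain t where t: "p = \<gamma> t" "t \<in> J"
      by blast
    obtain J0 \<delta> where "t \<in> J0" "integral_curve A W X J0 \<delta>" "\<forall>s\<in>J0. \<gamma> s = \<delta> s"
      using local[OF t(2)] by blast
    then show "p \<in> W"
      using integral_curve_at(1)[of A W X J0 \<delta> t] t by simp
  qed
  fix t assume t: "t \<in> J"
  then obtain J0 \<delta> where \<delta>: "t \<in> J0" "integral_curve A W X J0 \<delta>" "\<And>s. s \<in> J0 \<Longrightarrow> \<gamma> s = \<delta> s"
    using local[OF t] by blast
  have W: "\<delta> t \<in> W"
    using integral_curve_at[OF \<delta>(2,1)] by simp
  then obtain c where c: "c \<in> A" "\<delta> t \<in> fst c"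
    using X[OF W] by (auto simp: tangent_bundle_def manifold_points_def)
  obtain N where N: "open N" "t \<in> N" "N \<subseteq> J0" "\<And>s. s \<in> N \<Longrightarrow> \<delta> s \<in> fst c"
    "\<And>s. s \<in> N \<Longrightarrow> ((snd c \<circ> \<delta>) has_vector_derivative X (\<delta> s) c) (at s)"
    using integral_curve_chart[OF A \<delta>(2,1) c] by metis
  have "((snd c \<circ> \<gamma>) has_vector_derivative X (\<gamma> s) c) (at s)" if s: "s \<in> N" for s
  proof -
    have "((snd c \<circ> \<gamma>) has_vector_derivative X (\<delta> s) c) (at s)"
      by (rule has_vector_derivative_transform_within_open[OF N(5)[OF s] N(1) s]) (use N(3) \<delta>(3) in auto)
    then show ?thesis
      using N(3) \<delta>(3) s by auto
  qed
  then show "\<exists>c\<in>A. \<exists>N. open N \<and> t \<in> N \<and>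
      (\<forall>s\<in>N. \<gamma> s \<in> fst c \<and> ((snd c \<circ> \<gamma>) has_vector_derivative X (\<gamma> s) c) (at s))"
    using c N \<delta>(3) by (metis subsetD)
qed (assumption)

lemma integral_curve_exists:
  assumes A: "differentiable_atlas A" and W: "openin (atlas_topology A) W"
    and X: "smooth_vector_field A W X" and p: "p \<in> W"
  obtains J \<gamma> where "integral_curve A W X J \<gamma>" "0 \<in> J" "\<gamma> 0 = p"
proof -
  obtain c where c: "c \<in> A" "p \<in> fst c"
    using W p openin_differentiable_atlas[OF A] by (auto simp: manifold_points_def)
  have inj: "inj_on (snd c) (fst c)"
    using differentiable_atlas_inj A c by blast
  let ?U = "snd c ` (fst c \<inter> W)"
  have "open ?U"
    using W c openin_differentiable_atlas[OF A] by auto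
  moreover have "ck_on 1 ?U (\<lambda>x. X (chart_inv c x) c)"
    using X c unfolding smooth_vector_field_def smooth_on_def by blast
  ultimately obtain e x where e: "e > 0" "x 0 = snd c p"
    "\<And>t. \<bar>t\<bar> < e \<Longrightarrow> x t \<in> ?U \<and> (x has_vector_derivative X (chart_inv c (x t)) c) (at t)"
    using C1_ode_solution[of ?U "snd c p" "\<lambda>x. X (chart_inv c x) c"] p c by blast
  define \<gamma> where "\<gamma> = chart_inv c \<circ> x"
  have inv: "\<gamma> t \<in> fst c \<inter> W \<and> snd c (\<gamma> t) = x t" if "\<bar>t\<bar> < e" for t
    using e(3)[OF that] chart_inv_chart[OF inj] by (auto simp: \<gamma>_def)
  have "integral_curve A W X {-e<..<e} \<gamma>"
  proof (rule integral_curveI[OF A])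
    show "(q, X q) \<in> tangent_bundle A" if "q \<in> W" for q
      using X that by (simp add: smooth_vector_field_def)
    show "{-e<..<e} \<noteq> {}" "\<gamma> ` {-e<..<e} \<subseteq> W"
      using e inv by (auto simp: abs_less_iff)
    have "((snd c \<circ> \<gamma>) has_vector_derivative X (\<gamma> s) c) (at s)" if s: "s \<in> {-e<..<e}" for s
    proof (rule has_vector_derivative_transform_within_open[of x _ _ "{-e<..<e}"])
      show "(x has_vector_derivative X (\<gamma> s) c) (at s)"
        using e(3)[of s] s by (auto simp: \<gamma>_def)
    qed (use s inv in auto)
    then show "\<exists>c\<in>A. \<exists>N. open N \<and> t \<in> N \<and>
      (\<forall>s\<in>N. \<gamma> s \<in> fst c \<and> ((snd c \<circ> \<gamma>) has_vector_derivative X (\<gamma> s) c) (at s))"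
      if "t \<in> {-e<..<e}" for t
      using that c inv by (intro bexI[of _ c] exI[of _ "{-e<..<e}"]) auto
  qed auto
  moreover have "\<gamma> 0 = p"
    using e(2) chart_inv_chart[OF inj c(2)] by (simp add: \<gamma>_def)
  ultimately show thesis
    using e(1) that[of "{-e<..<e}" \<gamma>] by auto
qed

text \<open>
  The derivative along a curve is the differential of \<open>f\<close> applied to the field, so it only depends on
  the point and on the value of the field there. This allows comparing curves of different fields
  through the same point.
\<close>

lemma function_derivative_along_curve:
  fixes f :: "'m \<Rightarrow> real"
  assumes A: "differentiable_atlas A" and \<gamma>: "integral_curve A W X J \<gamma>"
    and t: "t \<in> J" "c \<in> A" "\<gamma> t \<in> fst c"
    and f: "(f \<circ> chart_inv c) differentiable (at (snd c (\<gamma> t)))"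
  shows "((f \<circ> \<gamma>) has_vector_derivative
           frechet_derivative (f \<circ> chart_inv c) (at (snd c (\<gamma> t))) (X (\<gamma> t) c)) (at t)"
proof -
  obtain N where N: "open N" "t \<in> N" "N \<subseteq> J" "\<And>s. s \<in> N \<Longrightarrow> \<gamma> s \<in> fst c"
    "\<And>s. s \<in> N \<Longrightarrow> ((snd c \<circ> \<gamma>) has_vector_derivative X (\<gamma> s) c) (at s)"
    using integral_curve_chart[OF A \<gamma> t] by metis
  have "((f \<circ> chart_inv c) has_derivative frechet_derivative (f \<circ> chart_inv c) (at (snd c (\<gamma> t))))
      (at ((snd c \<circ> \<gamma>) t))"
    using f by (simp add: frechet_derivative_works)
  from has_derivative_at_withinI[OF this] have "(((f \<circ> chart_inv c) \<circ> (snd c \<circ> \<gamma>)) has_vector_derivative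
      frechet_derivative (f \<circ> chart_inv c) (at (snd c (\<gamma> t))) (X (\<gamma> t) c)) (at t)"
    by (rule vector_derivative_diff_chain_within[OF N(5)[OF N(2)]])
  then show ?thesis
    by (rule has_vector_derivative_transform_within_open[OF _ N(1,2)])
      (simp add: chart_inv_chart[OF differentiable_atlas_inj[OF A t(2)] N(4)])
qed


section \<open>The tangent atlas and the Liouville field\<close>

lemma transition_derivative_self:
  assumes "differentiable_atlas A" "c \<in> A" "p \<in> fst c"
  shows "frechet_derivative (transition c c) (at (snd c p)) v = v"
proof -
  have "open (snd c ` fst c)"
    using assms by (auto simp: differentiable_atlas_def dest!: bspec[of A _ c])
  then have "(transition c c has_derivative (\<lambda>v. v)) (at (snd c p))"
    using assms(3) transition_chart[OF differentiable_atlas_inj[OF assms(1,2)], of _ c]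
    by (intro has_derivative_transform_within_open[OF has_derivative_ident]) auto
  then show ?thesis
    using frechet_derivative_at by metis
qed

text \<open>
  The chain rule for coordinate changes, which makes the transformation law of tangent vectors
  consistent.
\<close>

lemma transition_derivative_cocycle:
  assumes A: "differentiable_atlas A" "c \<in> A" "d \<in> A" "e \<in> A"
    and p: "p \<in> fst c" "p \<in> fst d" "p \<in> fst e"
  shows "frechet_derivative (transition c e) (at (snd c p)) v =
    frechet_derivative (transition d e) (at (snd d p)) (frechet_derivative (transition c d) (at (snd c p)) v)"
proof -
  note tr = transition_chart[OF differentiable_atlas_inj[OF A(1)]]
  have "(transition d e has_derivative frechet_derivative (transition d e) (at (snd d p)))
      (at (transition c d (snd c p)))"
    using differentiable_atlas_transition[OF A(1,3,4) p(2,3)] A p by (simp add: tr)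
  from diff_chain_at[OF differentiable_atlas_transition[OF A(1-3) p(1,2)] this]
  have "(transition c e has_derivative
      frechet_derivative (transition d e) (at (snd d p)) \<circ> frechet_derivative (transition c d) (at (snd c p)))
      (at (snd c p))"
  proof (rule has_derivative_transform_within_open)
    show "open (snd c ` (fst c \<inter> fst d))"
      using A by (simp add: differentiable_atlas_def)
  qed (use p A in \<open>auto simp: tr\<close>)
  then show ?thesis
    using frechet_derivative_at by (metis comp_apply)
qed

text \<open>
  The components in one chart can be prescribed. This is what makes the image of a chart of the tangent
  bundle a product, and hence open.
\<close>

lemma tangent_vector_exists:
  assumes A: "differentiable_atlas A" "c \<in> A" and p: "p \<in> fst c"
  obtains \<xi> where "\<xi> \<in> tangent_bundle A" "fst \<xi> = p" "snd \<xi> c = v"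
proof
  let ?\<xi> = "(p, \<lambda>d. if d \<in> A \<and> p \<in> fst d then frechet_derivative (transition c d) (at (snd c p)) v else 0)"
  show "?\<xi> \<in> tangent_bundle A"
    unfolding tangent_bundle_def mem_Collect_eq prod.case
  proof (intro conjI ballI impI allI)
    show "p \<in> manifold_points A"
      using A p by (auto simp: manifold_points_def)
    fix d e assume "d \<in> A" "e \<in> A" "p \<in> fst d \<inter> fst e"
    then show "(if e \<in> A \<and> p \<in> fst e then frechet_derivative (transition c e) (at (snd c p)) v else 0) =
      frechet_derivative (transition d e) (at (snd d p))
       (if d \<in> A \<and> p \<in> fst d then frechet_derivative (transition c d) (at (snd c p)) v else 0)"
      using transition_derivative_cocycle[OF A(1,2), of d e p v] p by simp
  qed auto
  show "snd ?\<xi> c = v"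
    using transition_derivative_self[OF A p] A p by simp
qed simp

lemma tangent_chart_simps [simp]:
  "\<xi> \<in> fst (tangent_chart A c) \<longleftrightarrow> \<xi> \<in> tangent_bundle A \<and> fst \<xi> \<in> fst c"
  "snd (tangent_chart A c) \<xi> = (snd c (fst \<xi>), snd \<xi> c)"
  by (simp_all add: tangent_chart_def)

lemma manifold_points_tangent_atlas [simp]: "manifold_points (tangent_atlas A) = tangent_bundle A"
proof -
  have "\<exists>c\<in>A. fst \<xi> \<in> fst c" if "\<xi> \<in> tangent_bundle A" for \<xi>
  proof -
    have "fst \<xi> \<in> manifold_points A"
      using that by (auto simp: tangent_bundle_def)
    then show ?thesis
      unfolding manifold_points_def by blast
  qed
  then show ?thesis
    unfolding manifold_points_def[of "tangent_atlas A"] by (auto simp: tangent_atlas_def)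
qed

lemma tangent_chart_inv:
  assumes "smooth_atlas A" "c \<in> A" "\<xi> \<in> tangent_bundle A" "fst \<xi> \<in> fst c"
  shows "chart_inv (tangent_chart A c) (snd c (fst \<xi>), snd \<xi> c) = \<xi>"
  using chart_inv_chart[OF inj_on_tangent_atlas[of c A], of \<xi>] assms
    differentiable_atlas_inj smooth_imp_differentiable_atlas by fastforce

lemma tangent_chart_image:
  fixes A :: "('m, 'e::euclidean_space) chart set"
  assumes "differentiable_atlas A" "c \<in> A" "d \<in> A"
  shows "snd (tangent_chart A c) ` (fst (tangent_chart A c) \<inter> fst (tangent_chart A d)) =
    (snd c ` (fst c \<inter> fst d)) \<times> UNIV"
proof (intro equalityI subsetI)
  fix z assume "z \<in> (snd c ` (fst c \<inter> fst d)) \<times> (UNIV :: 'e set)"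
  then obtain p where p: "p \<in> fst c" "p \<in> fst d" "fst z = snd c p"
    by auto
  obtain \<xi> where "\<xi> \<in> tangent_bundle A" "fst \<xi> = p" "snd \<xi> c = snd z"
    using tangent_vector_exists[OF assms(1,2) p(1)] by metis
  then show "z \<in> snd (tangent_chart A c) ` (fst (tangent_chart A c) \<inter> fst (tangent_chart A d))"
    using p by (intro image_eqI[of _ _ \<xi>]) (auto simp: prod_eq_iff)
qed auto

lemma tangent_transition:
  assumes A: "smooth_atlas A" "c \<in> A" "d \<in> A" and x: "x \<in> snd c ` (fst c \<inter> fst d)"
  shows "transition (tangent_chart A c) (tangent_chart A d) (x, v) =
    (transition c d x, frechet_derivative (transition c d) (at x) v)"
proof -
  note dA = smooth_imp_differentiable_atlas[OF A(1)]
  obtain p where p: "p \<in> fst c" "p \<in> fst d" "x = snd c p"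
    using x by auto
  obtain \<xi> where \<xi>: "\<xi> \<in> tangent_bundle A" "fst \<xi> = p" "snd \<xi> c = v"
    using tangent_vector_exists[OF dA A(2) p(1)] by metis
  have "transition (tangent_chart A c) (tangent_chart A d) (x, v) = (snd d p, snd \<xi> d)"
    using tangent_chart_inv[OF A(1,2) \<xi>(1)] \<xi> p by (simp add: transition_def)
  also have "snd d p = transition c d x"
    using transition_chart[OF differentiable_atlas_inj[OF dA A(2)] p(1)] p by simp
  also have "snd \<xi> d = frechet_derivative (transition c d) (at x) v"
    using tangent_bundle_transform[of p "snd \<xi>" A c d] \<xi> p A by auto
  finally show ?thesis .
qed

text \<open>
  Second derivatives are known in each fixed direction only. So the vertical part of the coordinate
  change is written as a sum over a basis, in which the derivatives are taken in fixed directions.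
\<close>

lemma differentiable_tangent_atlas:
  fixes A :: "('m, 'e::euclidean_space) chart set"
  assumes A: "smooth_atlas A"
  shows "differentiable_atlas (tangent_atlas A)"
proof -
  note dA = smooth_imp_differentiable_atlas[OF A]
  have inj: "inj_on (snd (tangent_chart A c)) (fst (tangent_chart A c))" if "c \<in> A" for c
    using inj_on_tangent_atlas[OF that] differentiable_atlas_inj[OF dA that] by blast
  have op: "open (snd c ` (fst c \<inter> fst d))" if "c \<in> A" "d \<in> A" for c d
    using dA that by (simp add: differentiable_atlas_def)
  have "transition (tangent_chart A c) (tangent_chart A d) differentiable (at z)"
    if c: "c \<in> A" "d \<in> A" and z: "z \<in> (snd c ` (fst c \<inter> fst d)) \<times> (UNIV :: 'e set)" for c d z
  proof -
    let ?S = "snd c ` (fst c \<inter> fst d)"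
    let ?D = "\<lambda>x. frechet_derivative (transition c d) (at x)"
    have C2: "ck_on (Suc 1) ?S (transition c d)"
      using A c unfolding smooth_atlas_def smooth_on_def by blast
    have lin: "linear (?D x)" if "x \<in> ?S" for x
      using ck_on_Suc_derivative[OF C2 that] has_derivative_linear by blast
    have fst_z: "fst z \<in> ?S"
      using z by auto
    have "(transition c d \<circ> fst) differentiable (at z)"
      using ck_on_Suc_derivative[OF C2 fst_z]
      by (intro differentiable_chain_at linear_imp_differentiable[OF linear_fst])
        (auto simp: differentiable_def)
    moreover have "((\<lambda>x. ?D x i) \<circ> fst) differentiable (at z)" for i
      using C2 fst_z
      by (intro differentiable_chain_at linear_imp_differentiable[OF linear_fst])
        (auto simp: differentiable_def)
    then have "(\<lambda>z. \<Sum>i\<in>Basis. (snd z \<bullet> i) *\<^sub>R ?D (fst z) i) differentiable (at z)"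
      by (auto intro!: differentiable_sum differentiable_scaleR differentiable_inner
          simp: o_def linear_imp_differentiable[OF linear_snd])
    ultimately have "(\<lambda>z. (transition c d (fst z), \<Sum>i\<in>Basis. (snd z \<bullet> i) *\<^sub>R ?D (fst z) i)) differentiable (at z)"
      unfolding o_def differentiable_def by (elim exE) (rule exI, rule has_derivative_Pair)
    then obtain D where D: "((\<lambda>z. (transition c d (fst z), \<Sum>i\<in>Basis. (snd z \<bullet> i) *\<^sub>R ?D (fst z) i)) has_derivative D) (at z)"
      by (auto simp: differentiable_def)
    have "(transition (tangent_chart A c) (tangent_chart A d) has_derivative D) (at z)"
    proof (rule has_derivative_transform_within_open[OF D _ z])
      show "open (?S \<times> (UNIV :: 'e set))"
        by (intro open_Times op c open_UNIV)
      fix w :: "'e \<times> 'e" assume w: "w \<in> ?S \<times> UNIV"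
      have "?D (fst w) (snd w) = ?D (fst w) (\<Sum>i\<in>Basis. (snd w \<bullet> i) *\<^sub>R i)"
        by (simp add: euclidean_representation)
      also have "\<dots> = (\<Sum>i\<in>Basis. (snd w \<bullet> i) *\<^sub>R ?D (fst w) i)"
        using w by (simp add: linear_sum[OF lin] linear_scale[OF lin] mem_Times_iff)
      finally show "(transition c d (fst w), \<Sum>i\<in>Basis. (snd w \<bullet> i) *\<^sub>R ?D (fst w) i) =
          transition (tangent_chart A c) (tangent_chart A d) w"
        using tangent_transition[OF A c, of "fst w" "snd w"] w by (simp add: mem_Times_iff)
    qed
    then show ?thesis
      by (auto simp: differentiable_def)
  qed
  then have "transition (tangent_chart A c) (tangent_chart A d) differentiable (at z)"
    if "c \<in> A" "d \<in> A"
      "z \<in> snd (tangent_chart A c) ` (fst (tangent_chart A c) \<inter> fst (tangent_chart A d))" for c d z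
    using that unfolding tangent_chart_image[OF dA that(1,2)] .
  moreover have "open (snd (tangent_chart A c) ` (fst (tangent_chart A c) \<inter> fst (tangent_chart A d)))"
    if "c \<in> A" "d \<in> A" for c d
    unfolding tangent_chart_image[OF dA that] by (intro open_Times op that open_UNIV)
  ultimately show ?thesis
    using inj unfolding differentiable_atlas_def tangent_atlas_def by blast
qed

text \<open>
  The vector field \<open>y\<^sup>i \<partial>/\<partial>y\<^sup>i\<close>, which generates the scaling of tangent vectors. For \<open>d\<close> the chart
  of the tangent bundle over \<open>c\<close>, the second component of \<open>snd d \<xi>\<close> is the vector \<open>y\<close>.
\<close>

definition liouville :: "('m, 'e::euclidean_space) chart set \<Rightarrow> ('m, 'e) tfield" where
  "liouville A \<xi> d = (if d \<in> tangent_atlas A \<and> \<xi> \<in> fst d then (0, snd (snd d \<xi>)) else 0)"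

lemma liouville_chart:
  "c \<in> A \<Longrightarrow> \<xi> \<in> tangent_bundle A \<Longrightarrow> fst \<xi> \<in> fst c \<Longrightarrow> liouville A \<xi> (tangent_chart A c) = (0, snd \<xi> c)"
  by (simp add: liouville_def tangent_atlas_def)

text \<open>
  The coordinate change of the tangent bundle is linear on each fibre, so its derivative in vertical
  directions is the coordinate change of the fibre.
\<close>

lemma transition_derivative_vertical:
  assumes A: "smooth_atlas A" "c \<in> A" "d \<in> A" and x: "x \<in> snd c ` (fst c \<inter> fst d)"
  shows "frechet_derivative (transition (tangent_chart A c) (tangent_chart A d)) (at (x, v)) (0, w) =
    (0, frechet_derivative (transition c d) (at x) w)"
proof -
  let ?T = "transition (tangent_chart A c) (tangent_chart A d)"
  let ?D = "frechet_derivative (transition c d) (at x)"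
  have dA: "differentiable_atlas A"
    using smooth_imp_differentiable_atlas[OF A(1)] .
  have lin: "linear ?D"
    using differentiable_atlas_transition[OF dA A(2,3)] x has_derivative_linear by blast
  have "(x, v) \<in> snd (tangent_chart A c) ` (fst (tangent_chart A c) \<inter> fst (tangent_chart A d))"
    using x tangent_chart_image[OF dA A(2,3)] by simp
  then have "?T differentiable (at (x, v))"
    using differentiable_tangent_atlas[OF A(1)] A(2,3)
    unfolding differentiable_atlas_def tangent_atlas_def by blast
  then have T: "(?T has_derivative frechet_derivative ?T (at (x, v))) (at ((\<lambda>s::real. (x, v + s *\<^sub>R w)) 0))"
    by (simp add: frechet_derivative_works)
  have line: "((\<lambda>s::real. (x, v + s *\<^sub>R w)) has_vector_derivative (0, w)) (at 0)"
    by (auto intro!: derivative_eq_intros)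
  from vector_derivative_diff_chain_within[OF line has_derivative_at_withinI[OF T]]
  have 1: "((\<lambda>s::real. ?T (x, v + s *\<^sub>R w)) has_vector_derivative
      frechet_derivative ?T (at (x, v)) (0, w)) (at 0)"
    by (simp only: o_def)
  have "(\<lambda>s::real. ?T (x, v + s *\<^sub>R w)) = (\<lambda>s. (transition c d x, ?D v + s *\<^sub>R ?D w))"
    by (rule ext) (simp add: tangent_transition[OF A x] linear_add[OF lin] linear_scale[OF lin])
  then have "((\<lambda>s::real. ?T (x, v + s *\<^sub>R w)) has_vector_derivative (0, ?D w)) (at 0)"
    by (auto intro!: derivative_eq_intros)
  then show ?thesis
    using vector_derivative_unique_at[OF 1] by simp
qed

lemma liouville_tangent:
  assumes A: "smooth_atlas A" and \<xi>: "\<xi> \<in> tangent_bundle A"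
  shows "(\<xi>, liouville A \<xi>) \<in> tangent_bundle (tangent_atlas A)"
  unfolding tangent_bundle_def[of "tangent_atlas A"] mem_Collect_eq prod.case
proof (intro conjI ballI impI)
  fix c' d' assume "c' \<in> tangent_atlas A" "d' \<in> tangent_atlas A" and in_both: "\<xi> \<in> fst c' \<inter> fst d'"
  then obtain c d where c: "c \<in> A" "c' = tangent_chart A c" and d: "d \<in> A" "d' = tangent_chart A d"
    by (auto simp: tangent_atlas_def)
  have cd: "fst \<xi> \<in> fst c" "fst \<xi> \<in> fst d"
    using in_both c d by auto
  have "snd \<xi> d = frechet_derivative (transition c d) (at (snd c (fst \<xi>))) (snd \<xi> c)"
    using tangent_bundle_transform[of "fst \<xi>" "snd \<xi>" A c d] \<xi> c d cd by simp
  then show "liouville A \<xi> d' =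
      frechet_derivative (transition c' d') (at (snd c' \<xi>)) (liouville A \<xi> c')"
    using transition_derivative_vertical[OF A c(1) d(1), of "snd c (fst \<xi>)"] c d cd \<xi>
    by (simp add: liouville_chart)
qed (use \<xi> in \<open>auto simp: liouville_def\<close>)

lemma tangent_bundle_add_scaleR:
  assumes A: "differentiable_atlas A" and v: "(p, v) \<in> tangent_bundle A" and w: "(p, w) \<in> tangent_bundle A"
  shows "(p, \<lambda>c. v c + r *\<^sub>R w c) \<in> tangent_bundle A"
  unfolding tangent_bundle_def mem_Collect_eq prod.case
proof (intro conjI ballI impI)
  show "p \<in> manifold_points A" "\<forall>c. c \<notin> A \<or> p \<notin> fst c \<longrightarrow> v c + r *\<^sub>R w c = 0"
    using v w by (auto simp: tangent_bundle_def)
  fix c d assume c: "c \<in> A" "d \<in> A" and p: "p \<in> fst c \<inter> fst d"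
  have lin: "linear (frechet_derivative (transition c d) (at (snd c p)))"
    using differentiable_atlas_transition[OF A c] p has_derivative_linear by blast
  show "v d + r *\<^sub>R w d = frechet_derivative (transition c d) (at (snd c p)) (v c + r *\<^sub>R w c)"
    using tangent_bundle_transform[OF v c] tangent_bundle_transform[OF w c] p
    by (simp add: linear_add[OF lin] linear_scale[OF lin])
qed


section \<open>Projective changes of a spray and changes of time\<close>

text \<open>
  The Liouville field has the components \<open>(0, y)\<close>, so adding \<open>\<kappa>\<close> times it changes the coefficients
  \<open>G\<^sup>i\<close> by \<open>- (\<kappa>/2) y\<^sup>i\<close>: the projective factor is \<open>P = - \<kappa>/2\<close>.
\<close>

definition projective_change ::
    "('m, 'e::euclidean_space) chart set \<Rightarrow> ('m, 'e) tfield \<Rightarrow> (('m, 'e) tvec \<Rightarrow> real) \<Rightarrow> ('m, 'e) tfield" where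
  "projective_change A G \<kappa> \<xi> d = G \<xi> d + \<kappa> \<xi> *\<^sub>R liouville A \<xi> d"

lemma spray_region:
  assumes "spray A C G"
  shows "openin (atlas_topology (tangent_atlas A)) C" "C \<subseteq> tangent_bundle A"
    "\<xi> \<in> C \<Longrightarrow> r > 0 \<Longrightarrow> tscale r \<xi> \<in> C"
    "smooth_vector_field (tangent_atlas A) C G"
    "\<xi> \<in> C \<Longrightarrow> (\<xi>, G \<xi>) \<in> tangent_bundle (tangent_atlas A)"
  using assms by (auto simp: spray_def conical_region_def slit_tangent_bundle_def smooth_vector_field_def)

lemma spray_chart:
  assumes "spray A C G" "c \<in> A" "\<xi> \<in> C" "fst \<xi> \<in> fst c"
  shows "fst (G \<xi> (tangent_chart A c)) = snd \<xi> c"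
    and "r > 0 \<Longrightarrow> snd (G (tscale r \<xi>) (tangent_chart A c)) = r\<^sup>2 *\<^sub>R snd (G \<xi> (tangent_chart A c))"
proof -
  have "spray_coeff A G c (tscale r \<xi>) = r\<^sup>2 *\<^sub>R spray_coeff A G c \<xi>" if "r > 0" for r
    using assms that by (auto simp: spray_def)
  then have "(- 2) *\<^sub>R spray_coeff A G c (tscale r \<xi>) = (- 2) *\<^sub>R r\<^sup>2 *\<^sub>R spray_coeff A G c \<xi>" if "r > 0" for r
    using that by simp
  then show "r > 0 \<Longrightarrow> snd (G (tscale r \<xi>) (tangent_chart A c)) = r\<^sup>2 *\<^sub>R snd (G \<xi> (tangent_chart A c))"
    by (simp add: spray_coeff_def)
qed (use assms in \<open>auto simp: spray_def\<close>)

lemma fst_tscale [simp]: "fst (tscale r \<xi>) = fst \<xi>"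
  and snd_tscale [simp]: "snd (tscale r \<xi>) c = r *\<^sub>R snd \<xi> c"
  and tscale_1 [simp]: "tscale 1 \<xi> = \<xi>"
  by (simp_all add: tscale_def)

lemma smooth_vector_field_projective_change:
  fixes A :: "('m, 'e::euclidean_space) chart set"
  assumes A: "smooth_atlas A" and C: "openin (atlas_topology (tangent_atlas A)) C" "C \<subseteq> tangent_bundle A"
    and X: "smooth_vector_field (tangent_atlas A) C X" and \<kappa>: "smooth_function (tangent_atlas A) C \<kappa>"
  shows "smooth_vector_field (tangent_atlas A) C (projective_change A X \<kappa>)"
  unfolding smooth_vector_field_def
proof (intro conjI ballI)
  fix \<xi> assume \<xi>: "\<xi> \<in> C"
  have "(\<xi>, X \<xi>) \<in> tangent_bundle (tangent_atlas A)"
    using X \<xi> by (simp add: smooth_vector_field_def)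
  from tangent_bundle_add_scaleR[OF differentiable_tangent_atlas[OF A] this liouville_tangent[OF A]]
  show "(\<xi>, projective_change A X \<kappa> \<xi>) \<in> tangent_bundle (tangent_atlas A)"
    using \<xi> C(2) unfolding projective_change_def[abs_def] by blast
next
  fix d assume d: "d \<in> tangent_atlas A"
  then obtain c where c: "c \<in> A" "d = tangent_chart A c"
    by (auto simp: tangent_atlas_def)
  note dTA = differentiable_tangent_atlas[OF A]
  let ?S = "snd d ` (fst d \<inter> C)"
  have S: "open ?S"
    using C(1) d by (simp add: openin_differentiable_atlas[OF dTA])
  have inv: "chart_inv d z \<in> fst d \<inter> C \<and> snd d (chart_inv d z) = z" if "z \<in> ?S" for z
    using that chart_inv_chart[OF differentiable_atlas_inj[OF dTA d]] by auto
  have lv: "liouville A (chart_inv d z) d = (0, snd z)" if "z \<in> ?S" for z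
    using inv[OF that] d by (simp add: liouville_def)
  have "ck_on k ?S (\<lambda>z. projective_change A X \<kappa> (chart_inv d z) d)" for k
  proof (rule ck_on_cong[OF S])
    show "ck_on k ?S (\<lambda>z. X (chart_inv d z) d + (\<kappa> \<circ> chart_inv d) z *\<^sub>R (0, snd z))"
    proof (rule ck_on_add[OF S _ ck_on_scaleR[OF S _ ck_on_bounded_linear[OF _ S]]])
      show "ck_on k ?S (\<lambda>z. X (chart_inv d z) d)"
        using X d unfolding smooth_vector_field_def smooth_on_def by blast
      show "ck_on k ?S (\<kappa> \<circ> chart_inv d)"
        using \<kappa> d unfolding smooth_function_def smooth_on_def by blast
      show "bounded_linear (\<lambda>z :: 'e \<times> 'e. (0 :: 'e, snd z))"
        by (intro bounded_linear_Pair bounded_linear_zero bounded_linear_snd)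
    qed
    show "X (chart_inv d z) d + (\<kappa> \<circ> chart_inv d) z *\<^sub>R (0, snd z) =
        projective_change A X \<kappa> (chart_inv d z) d" if "z \<in> ?S" for z
      using lv[OF that] by (simp add: projective_change_def)
  qed
  then show "smooth_on ?S (\<lambda>z. projective_change A X \<kappa> (chart_inv d z) d)"
    by (simp add: smooth_on_def)
qed

lemma projective_change_chart:
  assumes "c \<in> A" "\<xi> \<in> tangent_bundle A" "fst \<xi> \<in> fst c"
  shows "projective_change A G \<kappa> \<xi> (tangent_chart A c) =
    (fst (G \<xi> (tangent_chart A c)), snd (G \<xi> (tangent_chart A c)) + \<kappa> \<xi> *\<^sub>R snd \<xi> c)"
  using assms by (simp add: projective_change_def liouville_chart prod_eq_iff)

lemma spray_projective_change:
  assumes A: "smooth_atlas A" and G: "spray A C G" and \<kappa>: "smooth_function (tangent_atlas A) C \<kappa>"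
    and hom: "\<And>\<xi> r. \<xi> \<in> C \<Longrightarrow> r > 0 \<Longrightarrow> \<kappa> (tscale r \<xi>) = r * \<kappa> \<xi>"
  shows "spray A C (projective_change A G \<kappa>)"
  unfolding spray_def
proof (intro conjI ballI impI allI)
  note reg = spray_region[OF G]
  show "conical_region A C"
    using G by (simp add: spray_def)
  show "smooth_vector_field (tangent_atlas A) C (projective_change A G \<kappa>)"
    by (rule smooth_vector_field_projective_change[OF A reg(1,2,4) \<kappa>])
  fix c \<xi> assume c: "c \<in> A" "\<xi> \<in> C" "fst \<xi> \<in> fst c"
  have TB: "\<xi> \<in> tangent_bundle A"
    using c reg(2) by blast
  show "fst (projective_change A G \<kappa> \<xi> (tangent_chart A c)) = snd \<xi> c"
    using projective_change_chart[OF c(1) TB c(3)] spray_chart(1)[OF G c] by simp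
  fix r :: real assume r: "r > 0"
  have TB': "tscale r \<xi> \<in> tangent_bundle A"
    using reg(2) reg(3)[OF c(2) r] by blast
  show "spray_coeff A (projective_change A G \<kappa>) c (tscale r \<xi>) =
      r\<^sup>2 *\<^sub>R spray_coeff A (projective_change A G \<kappa>) c \<xi>"
    using projective_change_chart[OF c(1) TB c(3)] projective_change_chart[OF c(1) TB', of G \<kappa>]
      spray_chart(2)[OF G c r] hom[OF c(2) r] c
    by (simp add: spray_coeff_def scaleR_right_distrib scaleR_right_diff_distrib power2_eq_square mult_ac)
qed

lemma projectively_related_change:
  assumes "C \<subseteq> tangent_bundle A"
  shows "projectively_related A C G (projective_change A G \<kappa>)"
  unfolding projectively_related_def
proof (intro exI[of _ "\<lambda>\<xi>. - \<kappa> \<xi> / 2"] ballI impI)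
  fix c \<xi> assume "c \<in> A" "\<xi> \<in> C" "fst \<xi> \<in> fst c"
  then show "spray_coeff A (projective_change A G \<kappa>) c \<xi> = spray_coeff A G c \<xi> + (- \<kappa> \<xi> / 2) *\<^sub>R snd \<xi> c"
    using projective_change_chart[of c A \<xi> G \<kappa>] assms
    by (auto simp: spray_coeff_def scaleR_right_distrib)
qed

text \<open>
  The change of time \<open>x \<circ> \<phi>\<close> of a geodesic has the velocity \<open>\<phi>' * x'(\<phi>)\<close> and the acceleration
  \<open>\<phi>'\<^sup>2 * x''(\<phi>) + \<phi>'' * x'(\<phi>)\<close>. The first summand is the spray at the new velocity, by homogeneity of
  degree 2, and the second is \<open>\<phi>''/\<phi>'\<close> times the Liouville field there.
\<close>

lemma reparametrized_integral_curve:
  assumes A: "smooth_atlas A" and G: "spray A C G" and G': "spray A C (projective_change A G \<kappa>)"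
    and \<xi>: "integral_curve (tangent_atlas A) C G J \<xi>"
    and J': "open J'" "is_interval J'" "J' \<noteq> {}" "\<And>t. t \<in> J' \<Longrightarrow> \<phi> t \<in> J"
    and d1: "\<And>t. t \<in> J' \<Longrightarrow> (\<phi> has_vector_derivative \<phi>' t) (at t)"
    and d2: "\<And>t. t \<in> J' \<Longrightarrow> (\<phi>' has_vector_derivative \<phi>'' t) (at t)"
    and pos: "\<And>t. t \<in> J' \<Longrightarrow> \<phi>' t > 0"
    and acc: "\<And>t. t \<in> J' \<Longrightarrow> \<phi>'' t = \<kappa> (tscale (\<phi>' t) (\<xi> (\<phi> t))) * \<phi>' t"
  shows "integral_curve (tangent_atlas A) C (projective_change A G \<kappa>) J' (\<lambda>t. tscale (\<phi>' t) (\<xi> (\<phi> t)))"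
proof (rule integral_curveI[OF differentiable_tangent_atlas[OF A] spray_region(5)[OF G'] J'(1-3)])
  note dTA = differentiable_tangent_atlas[OF A]
  note reg = spray_region[OF G]
  have inC: "\<xi> (\<phi> t) \<in> C" if "t \<in> J'" for t
    using integral_curve_at(1)[OF \<xi> J'(4)[OF that]] .
  have in'C: "tscale (\<phi>' t) (\<xi> (\<phi> t)) \<in> C" if "t \<in> J'" for t
    using reg(3)[OF inC[OF that] pos[OF that]] .
  show "(\<lambda>t. tscale (\<phi>' t) (\<xi> (\<phi> t))) ` J' \<subseteq> C"
    using in'C by auto
  fix t assume t: "t \<in> J'"
  have "\<xi> (\<phi> t) \<in> manifold_points (tangent_atlas A)"
    using inC[OF t] reg(2) by auto
  then obtain c where c: "c \<in> A" "\<xi> (\<phi> t) \<in> fst (tangent_chart A c)"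
    unfolding manifold_points_def[of "tangent_atlas A"] unfolding tangent_atlas_def by blast
  let ?d = "tangent_chart A c"
  have d: "?d \<in> tangent_atlas A"
    using c by (simp add: tangent_atlas_def)
  obtain N where N: "open N" "\<phi> t \<in> N" "\<And>s. s \<in> N \<Longrightarrow> \<xi> s \<in> fst ?d"
    "\<And>s. s \<in> N \<Longrightarrow> ((snd ?d \<circ> \<xi>) has_vector_derivative G (\<xi> s) ?d) (at s)"
    using integral_curve_chart[OF dTA \<xi> J'(4)[OF t] d c(2)] by metis
  obtain N' where N': "open N'" "t \<in> N'" "N' \<subseteq> J'" "\<And>s. s \<in> N' \<Longrightarrow> \<phi> s \<in> N"
    using isCont_nbhd[OF has_vector_derivative_continuous[OF d1[OF t]] N(1,2) J'(1) t] by metis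
  have "((snd ?d \<circ> (\<lambda>t. tscale (\<phi>' t) (\<xi> (\<phi> t)))) has_vector_derivative
      projective_change A G \<kappa> (tscale (\<phi>' s) (\<xi> (\<phi> s))) ?d) (at s)" if s: "s \<in> N'" for s
  proof -
    have sJ: "s \<in> J'"
      using s N' by blast
    let ?u = "snd ?d \<circ> \<xi> \<circ> \<phi>"
    have u: "(?u has_vector_derivative \<phi>' s *\<^sub>R G (\<xi> (\<phi> s)) ?d) (at s)"
      by (rule vector_diff_chain_at[OF d1[OF sJ] N(4)[OF N'(4)[OF s]]])
    have u1: "((\<lambda>t. fst (?u t)) has_vector_derivative fst (\<phi>' s *\<^sub>R G (\<xi> (\<phi> s)) ?d)) (at s)"
      by (rule bounded_linear.has_vector_derivative[OF bounded_linear_fst u])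
    have u2: "((\<lambda>t. snd (?u t)) has_vector_derivative snd (\<phi>' s *\<^sub>R G (\<xi> (\<phi> s)) ?d)) (at s)"
      by (rule bounded_linear.has_vector_derivative[OF bounded_linear_snd u])
    have "((\<lambda>t. (fst (?u t), \<phi>' t *\<^sub>R snd (?u t))) has_vector_derivative
        (fst (\<phi>' s *\<^sub>R G (\<xi> (\<phi> s)) ?d),
         \<phi>' s *\<^sub>R snd (\<phi>' s *\<^sub>R G (\<xi> (\<phi> s)) ?d) + \<phi>'' s *\<^sub>R snd (?u s))) (at s)"
      using d2[OF sJ]
      by (intro has_vector_derivative_Pair u1 has_vector_derivative_scaleR u2)
        (simp add: has_real_derivative_iff_has_vector_derivative)
    moreover have "projective_change A G \<kappa> (tscale (\<phi>' s) (\<xi> (\<phi> s))) ?d =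
        (fst (\<phi>' s *\<^sub>R G (\<xi> (\<phi> s)) ?d),
         \<phi>' s *\<^sub>R snd (\<phi>' s *\<^sub>R G (\<xi> (\<phi> s)) ?d) + \<phi>'' s *\<^sub>R snd (?u s))"
    proof -
      have cs: "fst (\<xi> (\<phi> s)) \<in> fst c" "fst (tscale (\<phi>' s) (\<xi> (\<phi> s))) \<in> fst c"
        using N(3)[OF N'(4)[OF s]] by auto
      have TB: "tscale (\<phi>' s) (\<xi> (\<phi> s)) \<in> tangent_bundle A"
        using in'C[OF sJ] reg(2) by blast
      show ?thesis
        using projective_change_chart[OF c(1) TB cs(2), of G \<kappa>]
          spray_chart[OF G c(1) inC[OF sJ] cs(1)] spray_chart(1)[OF G c(1) in'C[OF sJ] cs(2)]
          pos[OF sJ] acc[OF sJ]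
        by (simp add: power2_eq_square)
    qed
    moreover have "snd ?d \<circ> (\<lambda>t. tscale (\<phi>' t) (\<xi> (\<phi> t))) = (\<lambda>t. (fst (?u t), \<phi>' t *\<^sub>R snd (?u t)))"
      by (simp add: fun_eq_iff)
    ultimately show ?thesis
      by simp
  qed
  moreover have "tscale (\<phi>' s) (\<xi> (\<phi> s)) \<in> fst ?d" if "s \<in> N'" for s
    using N(3)[OF N'(4)[OF that]] in'C[of s] that N'(3) reg(2) by auto
  ultimately show "\<exists>c\<in>tangent_atlas A. \<exists>N. open N \<and> t \<in> N \<and> (\<forall>s\<in>N. tscale (\<phi>' s) (\<xi> (\<phi> s)) \<in> fst c \<and>
      ((snd c \<circ> (\<lambda>t. tscale (\<phi>' t) (\<xi> (\<phi> t)))) has_vector_derivative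
        projective_change A G \<kappa> (tscale (\<phi>' s) (\<xi> (\<phi> s))) c) (at s))"
    using d N'(1,2) by blast
qed (assumption)

lemma projective_change_0 [simp]: "projective_change A G (\<lambda>_. 0) = G"
  by (simp add: projective_change_def fun_eq_iff)

text \<open>
  Changing the time back is again a change of time, between the same two sprays in the reverse order.
\<close>

lemma projective_change_minus [simp]:
  "projective_change A (projective_change A G \<kappa>) (\<lambda>\<xi>. - \<kappa> \<xi>) = G"
  by (simp add: projective_change_def fun_eq_iff)

text \<open>
  An affine time has no second derivative, so this is the change of time with \<open>\<kappa> = 0\<close>.
\<close>

lemma affine_integral_curve:
  assumes A: "smooth_atlas A" and G: "spray A C G" and \<xi>: "integral_curve (tangent_atlas A) C G J \<xi>"
    and r: "r > 0"
  shows "integral_curve (tangent_atlas A) C G {t. r * t + t0 \<in> J} (\<lambda>t. tscale r (\<xi> (r * t + t0)))"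
proof -
  let ?J = "{t. r * t + t0 \<in> J}"
  have J: "open J" "is_interval J" "J \<noteq> {}"
    using \<xi> by (auto simp: integral_curve_def)
  have "open ((\<lambda>t. r * t + t0) -` J)"
    using J(1) by (intro open_vimage continuous_intros)
  then have "open ?J"
    by (simp add: vimage_def)
  moreover have "is_interval ?J"
    unfolding is_interval_1
  proof (intro ballI allI impI)
    fix a b x assume "a \<in> ?J" "b \<in> ?J" "a \<le> x \<and> x \<le> b"
    then show "x \<in> ?J"
      using J(2)[unfolded is_interval_1, rule_format, of "r * a + t0" "r * b + t0" "r * x + t0"] r
      by auto
  qed
  moreover have "?J \<noteq> {}"
  proof -
    obtain s where "s \<in> J"
      using J(3) by blast
    then have "(s - t0) / r \<in> ?J"
      using r by simp
    then show ?thesis by blast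
  qed
  ultimately have "integral_curve (tangent_atlas A) C (projective_change A G (\<lambda>_. 0)) ?J
      (\<lambda>t. tscale r (\<xi> (r * t + t0)))"
    using r G by (intro reparametrized_integral_curve[OF A G _ \<xi>, where \<phi>'' = "\<lambda>_. 0"])
      (auto intro!: derivative_eq_intros)
  then show ?thesis
    by simp
qed

text \<open>
  Euler's identity for functions that are homogeneous of degree 1, obtained by differentiating along
  the ray through \<open>\<xi>\<close>.
\<close>

lemma liouville_derivative_homogeneous:
  fixes f :: "('m, 'e::euclidean_space) tvec \<Rightarrow> real"
  assumes A: "smooth_atlas A" and G: "spray A C G" and f: "smooth_function (tangent_atlas A) C f"
    and hom: "\<And>r. r > 0 \<Longrightarrow> f (tscale r \<xi>) = r * f \<xi>"
    and \<xi>: "\<xi> \<in> C" "c \<in> A" "fst \<xi> \<in> fst c"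
  shows "frechet_derivative (f \<circ> chart_inv (tangent_chart A c)) (at (snd (tangent_chart A c) \<xi>))
    (0, snd \<xi> c) = f \<xi>"
    and "(f \<circ> chart_inv (tangent_chart A c)) differentiable (at (snd (tangent_chart A c) \<xi>))"
proof -
  let ?d = "tangent_chart A c"
  let ?f = "f \<circ> chart_inv ?d"
  note reg = spray_region[OF G]
  have d: "?d \<in> tangent_atlas A"
    using \<xi> by (simp add: tangent_atlas_def)
  have "ck_on 1 (snd ?d ` (fst ?d \<inter> C)) ?f"
    using f d unfolding smooth_function_def smooth_on_def by blast
  moreover have "snd ?d \<xi> \<in> snd ?d ` (fst ?d \<inter> C)"
    using \<xi> reg(2) by (intro imageI) auto
  ultimately show diff: "?f differentiable (at (snd ?d \<xi>))"
    unfolding One_nat_def ck_on.simps by blast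
  let ?l = "\<lambda>r. (snd c (fst \<xi>), r *\<^sub>R snd \<xi> c)"
  have line: "(?l has_vector_derivative (0, snd \<xi> c)) (at 1)"
    by (auto intro!: derivative_eq_intros)
  have "(?f has_derivative frechet_derivative ?f (at (snd ?d \<xi>))) (at (?l 1))"
    using diff by (simp add: frechet_derivative_works)
  from vector_derivative_diff_chain_within[OF line has_derivative_at_withinI[OF this]]
  have "((?f \<circ> ?l) has_vector_derivative frechet_derivative ?f (at (snd ?d \<xi>)) (0, snd \<xi> c)) (at 1)" .
  moreover have "((?f \<circ> ?l) has_vector_derivative f \<xi>) (at 1)"
  proof (rule has_vector_derivative_transform_within_open[of "\<lambda>r. r * f \<xi>" _ _ "{0<..}"])
    show "((\<lambda>r. r * f \<xi>) has_vector_derivative f \<xi>) (at 1)"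
      by (auto intro!: derivative_eq_intros)
    fix r :: real assume "r \<in> {0<..}"
    then have r: "r > 0" by simp
    have "tscale r \<xi> \<in> tangent_bundle A"
      using reg(2) reg(3)[OF \<xi>(1) r] by blast
    then have "chart_inv ?d (?l r) = tscale r \<xi>"
      using tangent_chart_inv[OF A \<xi>(2), of "tscale r \<xi>"] \<xi>(3) by simp
    then show "r * f \<xi> = (?f \<circ> ?l) r"
      using hom[OF r] by simp
  qed auto
  ultimately show "frechet_derivative ?f (at (snd ?d \<xi>)) (0, snd \<xi> c) = f \<xi>"
    using vector_derivative_unique_at by blast
qed

text \<open>
  The field is \<open>G\<close> plus \<open>\<kappa>\<close> times the Liouville field, and a differential is linear. The contribution
  of \<open>G\<close> is read off any integral curve \<open>\<eta>\<close> of \<open>G\<close> through the same point, and that of the Liouville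
  field is given by Euler's identity.
\<close>

lemma derivative_along_projective_change:
  fixes f :: "('m, 'e::euclidean_space) tvec \<Rightarrow> real"
  assumes A: "smooth_atlas A" and G: "spray A C G" and f: "smooth_function (tangent_atlas A) C f"
    and hom: "\<And>\<xi> r. \<xi> \<in> C \<Longrightarrow> r > 0 \<Longrightarrow> f (tscale r \<xi>) = r * f \<xi>"
    and \<eta>: "integral_curve (tangent_atlas A) C G I \<eta>" "0 \<in> I" "\<eta> 0 = \<xi> t"
    and fG: "((f \<circ> \<eta>) has_vector_derivative y) (at 0)"
    and \<xi>: "integral_curve (tangent_atlas A) C (projective_change A G \<kappa>) J \<xi>" "t \<in> J"
  shows "((f \<circ> \<xi>) has_vector_derivative y + \<kappa> (\<xi> t) * f (\<xi> t)) (at t)"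
proof -
  note dTA = differentiable_tangent_atlas[OF A]
  have C: "\<xi> t \<in> C"
    using integral_curve_at(1)[OF \<xi>] .
  then have TB: "\<xi> t \<in> tangent_bundle A"
    using spray_region(2)[OF G] by blast
  then have "\<xi> t \<in> manifold_points (tangent_atlas A)"
    by simp
  then obtain c where c: "c \<in> A" "\<xi> t \<in> fst (tangent_chart A c)"
    unfolding manifold_points_def[of "tangent_atlas A"] unfolding tangent_atlas_def by blast
  let ?d = "tangent_chart A c"
  let ?D = "frechet_derivative (f \<circ> chart_inv ?d) (at (snd ?d (\<xi> t)))"
  have d: "?d \<in> tangent_atlas A" and cb: "fst (\<xi> t) \<in> fst c"
    using c by (auto simp: tangent_atlas_def)
  note L = liouville_derivative_homogeneous[OF A G f hom[OF C] C c(1) cb]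
  have "((f \<circ> \<eta>) has_vector_derivative
      frechet_derivative (f \<circ> chart_inv ?d) (at (snd ?d (\<eta> 0))) (G (\<eta> 0) ?d)) (at 0)"
    by (rule function_derivative_along_curve[OF dTA \<eta>(1,2) d]) (use c(2) L(2) \<eta>(3) in simp_all)
  then have "((f \<circ> \<eta>) has_vector_derivative ?D (G (\<xi> t) ?d)) (at 0)"
    by (simp only: \<eta>(3))
  then have D0: "?D (G (\<xi> t) ?d) = y"
    by (rule vector_derivative_unique_at[OF _ fG])
  have lin: "linear ?D"
    using L(2) has_derivative_linear frechet_derivative_works by blast
  have "?D (projective_change A G \<kappa> (\<xi> t) ?d) = ?D (G (\<xi> t) ?d) + \<kappa> (\<xi> t) * ?D (0, snd (\<xi> t) c)"
    unfolding projective_change_def liouville_chart[OF c(1) TB cb]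
    by (simp only: linear_add[OF lin] linear_scale[OF lin] real_scaleR_def)
  then have "?D (projective_change A G \<kappa> (\<xi> t) ?d) = y + \<kappa> (\<xi> t) * f (\<xi> t)"
    using D0 L(1) by simp
  then show ?thesis
    using function_derivative_along_curve[OF dTA \<xi> d c(2) L(2)] by simp
qed


section \<open>Maximal geodesics\<close>

text \<open>
  The first component of a spray is the vector itself, so an integral curve is determined by its
  projection. In particular the choice of a lift in the notion of a geodesic is immaterial.
\<close>

lemma velocity_lift:
  assumes A: "smooth_atlas A" and G: "spray A C G" and \<xi>: "integral_curve (tangent_atlas A) C G J \<xi>"
    and x: "\<And>t. t \<in> J \<Longrightarrow> x t = fst (\<xi> t)" and t: "t \<in> J"
  shows "velocity A x t = \<xi> t"
proof -
  note dTA = differentiable_tangent_atlas[OF A]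
  have C: "\<xi> t \<in> C"
    using integral_curve_at(1)[OF \<xi> t] .
  then have TB: "\<xi> t \<in> tangent_bundle A"
    using spray_region(2)[OF G] by blast
  have "vector_derivative (snd c \<circ> x) (at t) = snd (\<xi> t) c" if c: "c \<in> A" "fst (\<xi> t) \<in> fst c" for c
  proof -
    let ?d = "tangent_chart A c"
    have d: "?d \<in> tangent_atlas A" "\<xi> t \<in> fst ?d"
      using c TB by (auto simp: tangent_atlas_def)
    have "((snd ?d \<circ> \<xi>) has_vector_derivative G (\<xi> t) ?d) (at t)"
      using integral_curve_at(2)[OF \<xi> t d] .
    from bounded_linear.has_vector_derivative[OF bounded_linear_fst this]
    have "((\<lambda>t. snd c (fst (\<xi> t))) has_vector_derivative snd (\<xi> t) c) (at t)"
      using spray_chart(1)[OF G c(1) C c(2)] by simp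
    then have "((snd c \<circ> x) has_vector_derivative snd (\<xi> t) c) (at t)"
      by (rule has_vector_derivative_transform_within_open[of _ _ _ J])
        (use \<xi> t x in \<open>auto simp: integral_curve_def\<close>)
    then show ?thesis
      by (rule vector_derivative_at)
  qed
  moreover have "snd (\<xi> t) c = 0" if "\<not> (c \<in> A \<and> fst (\<xi> t) \<in> fst c)" for c
  proof -
    have "\<forall>c. c \<notin> A \<or> fst (\<xi> t) \<notin> fst c \<longrightarrow> snd (\<xi> t) c = 0"
      using TB unfolding tangent_bundle_def mem_Collect_eq split_beta by (elim conjE)
    then show ?thesis
      using that by blast
  qed
  ultimately have "snd (velocity A x t) c = snd (\<xi> t) c" for c
    unfolding velocity_def using x[OF t] by auto
  then show ?thesis
    using x[OF t] by (simp add: velocity_def prod_eq_iff fun_eq_iff)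
qed

lemma geodesic_velocity:
  assumes A: "smooth_atlas A" and G: "spray A C G" and x: "geodesic A C G J x"
  shows "integral_curve (tangent_atlas A) C G J (velocity A x)"
proof -
  obtain \<xi> where \<xi>: "integral_curve (tangent_atlas A) C G J \<xi>" "\<And>t. t \<in> J \<Longrightarrow> x t = fst (\<xi> t)"
    using x by (auto simp: geodesic_def)
  show ?thesis
  proof (rule integral_curve_cong[OF differentiable_tangent_atlas[OF A] spray_region(5)[OF G]])
    show "\<exists>J0 \<delta>. t \<in> J0 \<and> integral_curve (tangent_atlas A) C G J0 \<delta> \<and> (\<forall>s\<in>J0. velocity A x s = \<delta> s)"
      if "t \<in> J" for t
      using that \<xi>(1) velocity_lift[OF A G \<xi>] by blast
  qed (use \<xi>(1) in \<open>auto simp: integral_curve_def\<close>)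
qed

lemma geodesicI: "integral_curve (tangent_atlas A) C G J \<xi> \<Longrightarrow> geodesic A C G J (\<lambda>t. fst (\<xi> t))"
  by (auto simp: geodesic_def)

lemma geodesic_fst_velocity: "fst (velocity A x t) = x t"
  by (simp add: velocity_def)

lemma is_interval_chain_Union:
  fixes K :: "real set set"
  assumes "\<And>I I'. I \<in> K \<Longrightarrow> I' \<in> K \<Longrightarrow> I \<subseteq> I' \<or> I' \<subseteq> I" "\<And>I. I \<in> K \<Longrightarrow> is_interval I"
  shows "is_interval (\<Union>K)"
  unfolding is_interval_1
proof (intro ballI allI impI)
  fix a b x assume "a \<in> \<Union>K" "b \<in> \<Union>K" and x: "a \<le> x \<and> x \<le> b"
  then obtain I where "I \<in> K" "a \<in> I" "b \<in> I"
    using assms(1) by blast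
  then show "x \<in> \<Union>K"
    using assms(2) x unfolding is_interval_1 by blast
qed

lemma geodesic_chain_union:
  assumes A: "smooth_atlas A" and G: "spray A C G" and ne: "K \<noteq> {}"
    and K: "\<And>J x. (J, x) \<in> K \<Longrightarrow> geodesic A C G J x"
    and chain: "\<And>J x J' x'. (J, x) \<in> K \<Longrightarrow> (J', x') \<in> K \<Longrightarrow> J \<subseteq> J' \<or> J' \<subseteq> J"
    and agree: "\<And>J x t. (J, x) \<in> K \<Longrightarrow> t \<in> J \<Longrightarrow> y t = x t"
  shows "geodesic A C G (\<Union> (fst ` K)) y"
proof -
  note v = geodesic_velocity[OF A G K]
  have props: "open J \<and> is_interval J \<and> J \<noteq> {}" if "(J, x) \<in> K" for J x
    using v[OF that] by (simp add: integral_curve_def)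
  have "integral_curve (tangent_atlas A) C G (\<Union> (fst ` K)) (velocity A y)"
  proof (rule integral_curve_cong[OF differentiable_tangent_atlas[OF A] spray_region(5)[OF G]])
    show "open (\<Union> (fst ` K))"
      using props by auto
    show "\<Union> (fst ` K) \<noteq> {}"
      using props ne by fastforce
    show "is_interval (\<Union> (fst ` K))"
      using props chain by (intro is_interval_chain_Union) force+
    fix t assume "t \<in> \<Union> (fst ` K)"
    then obtain J x where J: "(J, x) \<in> K" "t \<in> J"
      by force
    have "velocity A y s = velocity A x s" if "s \<in> J" for s
      by (rule velocity_lift[OF A G v[OF J(1)] _ that]) (simp add: geodesic_fst_velocity agree[OF J(1)])
    then show "\<exists>J0 \<delta>. t \<in> J0 \<and> integral_curve (tangent_atlas A) C G J0 \<delta> \<and> (\<forall>s\<in>J0. velocity A y s = \<delta> s)"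
      using J(2) v[OF J(1)] by blast
  qed
  from geodesicI[OF this] show ?thesis
    by (simp add: geodesic_fst_velocity)
qed

text \<open>
  Zorn's lemma for the graphs of the extensions, ordered by inclusion. The union of a chain of graphs is
  the graph of a geodesic by \<open>geodesic_chain_union\<close>, as being a geodesic is a local property.
\<close>

lemma maximal_geodesic_exists:
  fixes A :: "('m, 'e::euclidean_space) chart set"
  assumes A: "smooth_atlas A" and G: "spray A C G" and x: "geodesic A C G J x"
  obtains I y where "maximal_geodesic A C G I y" "J \<subseteq> I" "\<And>t. t \<in> J \<Longrightarrow> y t = x t"
proof -
  define graph where "graph p = (\<lambda>t. (t, snd p t)) ` fst p" for p :: "real set \<times> (real \<Rightarrow> 'm)"
  define E where "E = {(I, y). geodesic A C G I y \<and> J \<subseteq> I \<and> (\<forall>t\<in>J. y t = x t)}"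
  have dom: "graph p \<subseteq> graph q \<Longrightarrow> fst p \<subseteq> fst q" for p q
    by (auto simp: graph_def)
  have agr: "graph p \<subseteq> graph q \<Longrightarrow> t \<in> fst p \<Longrightarrow> snd p t = snd q t" for p q t
    by (auto simp: graph_def)
  have "\<exists>M\<in>graph ` E. \<forall>X\<in>graph ` E. M \<subseteq> X \<longrightarrow> X = M"
  proof (rule subset_Zorn_nonempty)
    show "graph ` E \<noteq> {}"
      using x by (auto simp: E_def)
    fix \<C> assume \<C>: "\<C> \<noteq> {}" "subset.chain (graph ` E) \<C>"
    define K where "K = {p \<in> E. graph p \<in> \<C>}"
    have CK: "\<C> = graph ` K"
      using \<C>(2) by (auto simp: K_def subset.chain_def)
    have total: "graph p \<subseteq> graph q \<or> graph q \<subseteq> graph p" if "p \<in> K" "q \<in> K" for p q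
      using \<C>(2) that unfolding K_def subset_chain_def by blast
    define y where "y t = snd (SOME p. p \<in> K \<and> t \<in> fst p) t" for t
    have y: "y t = snd p t" if p: "p \<in> K" "t \<in> fst p" for p t
    proof -
      define q where "q = (SOME p. p \<in> K \<and> t \<in> fst p)"
      have q: "q \<in> K" "t \<in> fst q"
        using someI[of "\<lambda>p. p \<in> K \<and> t \<in> fst p" p] p by (simp_all add: q_def)
      have "snd q t = snd p t"
        using total[OF p(1) q(1)] agr[of p q t] agr[of q p t] p(2) q(2) by auto
      then show ?thesis
        by (simp add: y_def q_def)
    qed
    have "(\<Union> (fst ` K), y) \<in> E"
      unfolding E_def mem_Collect_eq prod.case
    proof (intro conjI ballI)
      show "geodesic A C G (\<Union> (fst ` K)) y"
      proof (rule geodesic_chain_union[OF A G])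
        show "K \<noteq> {}"
          using \<C>(1) CK by blast
        show "geodesic A C G I z" if "(I, z) \<in> K" for I z
          using that by (auto simp: K_def E_def)
        show "I \<subseteq> I' \<or> I' \<subseteq> I" if "(I, z) \<in> K" "(I', z') \<in> K" for I z I' z'
          using total[OF that] dom[of "(I, z)" "(I', z')"] dom[of "(I', z')" "(I, z)"] by auto
        show "y t = z t" if "(I, z) \<in> K" "t \<in> I" for I z t
          using y[OF that(1)] that(2) by simp
      qed
      obtain p where p: "p \<in> K"
        using \<C>(1) CK by blast
      then have pE: "J \<subseteq> fst p" "\<And>t. t \<in> J \<Longrightarrow> snd p t = x t"
        by (auto simp: K_def E_def)
      show "J \<subseteq> \<Union> (fst ` K)"
        using p pE by blast
      show "y t = x t" if "t \<in> J" for t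
        using y[OF p, of t] pE that by auto
    qed
    moreover have "\<Union>\<C> = graph (\<Union> (fst ` K), y)"
    proof (intro equalityI subsetI)
      fix z assume "z \<in> \<Union>\<C>"
      then obtain p where p: "p \<in> K" "z \<in> graph p"
        unfolding CK by blast
      then show "z \<in> graph (\<Union> (fst ` K), y)"
        using y[OF p(1)] by (auto simp: graph_def)
    next
      fix z assume "z \<in> graph (\<Union> (fst ` K), y)"
      then obtain t p where t: "z = (t, y t)" "p \<in> K" "t \<in> fst p"
        by (auto simp: graph_def)
      then have "z \<in> graph p"
        using y[OF t(2,3)] by (auto simp: graph_def)
      then show "z \<in> \<Union>\<C>"
        unfolding CK using t(2) by blast
    qed
    ultimately show "\<Union>\<C> \<in> graph ` E"
      by (metis imageI)
  qed
  then obtain I y where Iy: "(I, y) \<in> E"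
    and max: "\<And>q. q \<in> E \<Longrightarrow> graph (I, y) \<subseteq> graph q \<Longrightarrow> graph q = graph (I, y)"
    by auto
  show thesis
  proof
    show "J \<subseteq> I" "\<And>t. t \<in> J \<Longrightarrow> y t = x t"
      using Iy by (auto simp: E_def)
    show "maximal_geodesic A C G I y"
      unfolding maximal_geodesic_def
    proof (intro conjI allI impI; (elim conjE)?)
      show "geodesic A C G I y"
        using Iy by (simp add: E_def)
      fix J' y' assume J': "geodesic A C G J' y'" "I \<subseteq> J'" "\<forall>t\<in>I. y' t = y t"
      have "(J', y') \<in> E" "graph (I, y) \<subseteq> graph (J', y')"
        using J' Iy by (auto simp: E_def graph_def)
      then have "graph (J', y') = graph (I, y)"
        by (rule max)
      then have "fst (J', y') \<subseteq> fst (I, y)"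
        by (intro dom) simp
      then show "J' = I"
        using J'(2) by simp
    qed
  qed
qed

text \<open>
  A proper extension after the affine change of time would give one before it, through the inverse
  affine change.
\<close>

lemma maximal_geodesic_affine:
  assumes A: "smooth_atlas A" and G: "spray A C G" and x: "maximal_geodesic A C G I x" and r: "r > 0"
  shows "maximal_geodesic A C G {s. r * s + t0 \<in> I} (\<lambda>s. x (r * s + t0))"
    and "r * s + t0 \<in> I \<Longrightarrow> velocity A (\<lambda>s. x (r * s + t0)) s = tscale r (velocity A x (r * s + t0))"
proof -
  have aff: "integral_curve (tangent_atlas A) C G {s. r * s + t0 \<in> J} (\<lambda>s. tscale r (velocity A y (r * s + t0)))"
    if "geodesic A C G J y" "r > 0" for r t0 J y
    by (rule affine_integral_curve[OF A G geodesic_velocity[OF A G that(1)] that(2)])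
  have geo: "geodesic A C G {s. r * s + t0 \<in> J} (\<lambda>s. y (r * s + t0))"
    if "geodesic A C G J y" "r > 0" for r t0 J y
    using geodesicI[OF aff[OF that]] by (simp add: geodesic_fst_velocity)
  have xg: "geodesic A C G I x"
    using x by (simp add: maximal_geodesic_def)
  show "velocity A (\<lambda>s. x (r * s + t0)) s = tscale r (velocity A x (r * s + t0))" if "r * s + t0 \<in> I"
    by (rule velocity_lift[OF A G aff[OF xg r]]) (use that in \<open>auto simp: geodesic_fst_velocity\<close>)
  show "maximal_geodesic A C G {s. r * s + t0 \<in> I} (\<lambda>s. x (r * s + t0))"
    unfolding maximal_geodesic_def
  proof (intro conjI allI impI geo[OF xg r]; elim conjE)
    fix J' y assume y: "geodesic A C G J' y" "{s. r * s + t0 \<in> I} \<subseteq> J'"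
      "\<forall>s\<in>{s. r * s + t0 \<in> I}. y s = x (r * s + t0)"
    let ?K = "{s. 1 / r * s + (- t0 / r) \<in> J'}"
    have "geodesic A C G ?K (\<lambda>s. y (1 / r * s + (- t0 / r)))"
      using r by (intro geo[OF y(1)]) simp
    moreover have inv: "r * (1 / r * s + (- t0 / r)) + t0 = s" for s
      using r by (simp add: field_simps)
    have "I \<subseteq> ?K"
      using y(2) inv by (auto simp: subset_iff simp del: times_divide_eq_left)
    moreover have "\<forall>s\<in>I. y (1 / r * s + (- t0 / r)) = x s"
      using y(3) inv by (metis mem_Collect_eq)
    ultimately have K: "?K = I"
      using x unfolding maximal_geodesic_def by blast
    have "s \<in> J' \<longleftrightarrow> r * s + t0 \<in> ?K" for s
      using r by (simp add: field_simps)
    then show "J' = {s. r * s + t0 \<in> I}"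
      unfolding K by auto
  qed
qed

lemma maximal_geodesic_through:
  assumes A: "smooth_atlas A" and G: "spray A C G" and \<xi>: "\<xi> \<in> C"
  obtains I x where "maximal_geodesic A C G I x" "0 \<in> I" "velocity A x 0 = \<xi>"
proof -
  obtain J \<gamma> where \<gamma>: "integral_curve (tangent_atlas A) C G J \<gamma>" "0 \<in> J" "\<gamma> 0 = \<xi>"
    using integral_curve_exists[OF differentiable_tangent_atlas[OF A] spray_region(1,4)[OF G] \<xi>] .
  obtain I x where x: "maximal_geodesic A C G I x" "J \<subseteq> I" "\<And>t. t \<in> J \<Longrightarrow> x t = fst (\<gamma> t)"
    using maximal_geodesic_exists[OF A G geodesicI[OF \<gamma>(1)]] by metis
  show thesis
    using that[OF x(1)] x(2) \<gamma>(2,3) velocity_lift[OF A G \<gamma>(1) x(3) \<gamma>(2)] by auto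
qed


section \<open>A change of time from the lifetime to the real line\<close>

text \<open>
  A lifetime \<open>(1/p, 1/q)\<close> is described by the reciprocals of its ends, where 0 stands for an infinite
  end. If \<open>p < p' \<le> 0\<close>, then \<open>1/p\<close> lies in the second interval but not in the first.
  Reflecting the intervals at 0 exchanges the roles of \<open>p\<close> and \<open>q\<close>.
\<close>

lemma interval_slopes_unique:
  fixes p q p' q' :: real
  assumes "p \<le> 0" "0 \<le> q" "p' \<le> 0" "0 \<le> q'"
    and eq: "{t. p * t < 1 \<and> q * t < 1} = {t. p' * t < 1 \<and> q' * t < 1}"
  shows "p = p'" "q = q'"
proof -
  have le_p: "p' \<le> p" if "p \<le> 0" "p' \<le> 0" "0 \<le> q'" "{t. p' * t < 1 \<and> q' * t < 1} \<subseteq> {t. p * t < 1 \<and> q * t < 1}"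
    for p q p' q' :: real
  proof (rule ccontr)
    assume "\<not> p' \<le> p"
    then have p: "p < 0" "p < p'"
      using that by auto
    have "p' * (1 / p) < 1" "q' * (1 / p) < 1"
      using p that by (auto simp: divide_less_eq intro: order_le_less_trans)
    then have "1 / p \<in> {t. p * t < 1 \<and> q * t < 1}"
      using that(4) by blast
    then show False
      using p by simp
  qed
  show p: "p = p'"
    using le_p[of p p' q' q] le_p[of p' p q q'] assms by auto
  have "{t. - q * t < 1 \<and> - p * t < 1} = {t. - q' * t < 1 \<and> - p' * t < 1}"
  proof -
    have "- t \<in> {t. p * t < 1 \<and> q * t < 1} \<longleftrightarrow> - t \<in> {t. p' * t < 1 \<and> q' * t < 1}" for t
      unfolding eq ..
    then show ?thesis
      by auto
  qed
  then show "q = q'"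
    using le_p[of "- q" "- q'" "- p'" "- p"] le_p[of "- q'" "- q" "- p" "- p'"] assms by auto
qed

text \<open>
  The inverse of \<open>stretch_inv\<close>, for \<open>p \<le> 0 \<le> q\<close> and \<open>p < q\<close>. It maps \<open>\<real>\<close> onto the lifetime \<open>(1/p, 1/q)\<close> and solves
  \<open>\<psi>' = (1 - p * \<psi>) * (1 - q * \<psi>)\<close> with \<open>\<psi> 0 = 0\<close>, so both
  maps have the derivative 1 at 0: these changes of time keep the velocity at time 0.
\<close>

definition stretch :: "real \<Rightarrow> real \<Rightarrow> real \<Rightarrow> real" where
  "stretch p q s = (exp ((q - p) * s) - 1) / (q * exp ((q - p) * s) - p)"

text \<open>
  The integral of \<open>q / (1 - q * t) - p / (1 - p * t)\<close>, divided by the value \<open>q - p\<close> of the integrand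
  at 0.
\<close>

definition stretch_inv :: "real \<Rightarrow> real \<Rightarrow> real \<Rightarrow> real" where
  "stretch_inv p q t = (ln (1 - p * t) - ln (1 - q * t)) / (q - p)"

lemma stretch_denominator:
  assumes "p \<le> 0" "0 \<le> q" "p < (q::real)"
  shows "q * exp ((q - p) * s) - p > 0"
proof (cases "q = 0")
  case False
  then have "q * exp ((q - p) * s) > 0"
    using assms by simp
  then show ?thesis
    using assms by linarith
qed (use assms in auto)

text \<open>
  These closed forms show at once that \<open>stretch\<close> takes values in the lifetime, and that the quotient of
  the two factors is the exponential that \<open>stretch_inv\<close> recovers.
\<close>

lemma stretch_factors:
  assumes "p \<le> 0" "0 \<le> q" "p < (q::real)"
  shows "1 - p * stretch p q s = (q - p) * exp ((q - p) * s) / (q * exp ((q - p) * s) - p)"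
    and "1 - q * stretch p q s = (q - p) / (q * exp ((q - p) * s) - p)"
  using stretch_denominator[OF assms, of s] by (simp_all add: stretch_def field_simps)

lemma stretch_range:
  assumes "p \<le> 0" "0 \<le> q" "p < (q::real)"
  shows "p * stretch p q s < 1" "q * stretch p q s < 1"
proof -
  have "1 - p * stretch p q s > 0" "1 - q * stretch p q s > 0"
    unfolding stretch_factors[OF assms] using stretch_denominator[OF assms, of s] assms by simp_all
  then show "p * stretch p q s < 1" "q * stretch p q s < 1"
    by simp_all
qed

lemma stretch_inv_stretch:
  assumes "p \<le> 0" "0 \<le> q" "p < (q::real)"
  shows "stretch_inv p q (stretch p q s) = s"
  using stretch_denominator[OF assms, of s] assms
  by (simp add: stretch_inv_def stretch_factors[OF assms] ln_div ln_mult)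

lemma stretch_stretch_inv:
  assumes "p < (q::real)" "p * t < 1" "q * t < 1"
  shows "stretch p q (stretch_inv p q t) = t"
proof -
  have E: "exp ((q - p) * stretch_inv p q t) = (1 - p * t) / (1 - q * t)"
    using assms by (simp add: stretch_inv_def exp_diff)
  have "(1 - p * t) / (1 - q * t) - 1 = (q - p) * t / (1 - q * t)"
    "q * ((1 - p * t) / (1 - q * t)) - p = (q - p) / (1 - q * t)"
    using assms by (simp_all add: field_simps)
  then show ?thesis
    using assms by (simp add: stretch_def E)
qed

lemma stretch_derivative:
  assumes "p \<le> 0" "0 \<le> q" "p < (q::real)"
  shows "(stretch p q has_real_derivative (1 - p * stretch p q s) * (1 - q * stretch p q s)) (at s)"
  unfolding stretch_factors[OF assms] stretch_def[abs_def]
  using stretch_denominator[OF assms, of s]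
  by (auto intro!: derivative_eq_intros simp: field_simps)

lemma stretch_inv_derivative:
  assumes "p < (q::real)" "p * t < 1" "q * t < 1"
  shows "(stretch_inv p q has_real_derivative 1 / ((1 - p * t) * (1 - q * t))) (at t)"
proof -
  have *: "- p / (1 - p * t) + q / (1 - q * t) = (q - p) / ((1 - p * t) * (1 - q * t))"
    using assms by (simp add: field_simps)
  have "(stretch_inv p q has_real_derivative (- p / (1 - p * t) + q / (1 - q * t)) / (q - p)) (at t)"
    unfolding stretch_inv_def[abs_def] using assms
    by (auto intro!: derivative_eq_intros)
  then show ?thesis
    unfolding * using assms by simp
qed

lemma stretch_inv_mono:
  assumes "p \<le> 0" "0 \<le> q" "p < (q::real)" "s \<le> t" "p * s < 1" "q * t < 1"
  shows "stretch_inv p q s \<le> stretch_inv p q t"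
proof -
  have "p * t \<le> p * s" "q * s \<le> q * t"
    using assms by (auto intro: mult_left_mono mult_left_mono_neg)
  then have "ln (1 - p * s) \<le> ln (1 - p * t)" "ln (1 - q * t) \<le> ln (1 - q * s)"
    using assms by auto
  then show ?thesis
    using assms by (simp add: stretch_inv_def divide_right_mono)
qed


section \<open>The completing spray\<close>

text \<open>
  The reciprocals \<open>\<alpha>\<close> and \<open>\<beta>\<close> of the ends of the lifetimes, where 0 stands for an infinite end, so that
  bounded and half-bounded lifetimes take the same form. They are the slopes of the linear conditions
  that cut out a lifetime.
\<close>

locale geodesic_lifetimes =
  fixes A :: "('m, 'e::euclidean_space) chart set" and C :: "('m, 'e) tvec set"
    and G :: "('m, 'e) tfield" and \<alpha> \<beta> :: "('m, 'e) tvec \<Rightarrow> real"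
  assumes A: "smooth_atlas A" and G: "spray A C G"
    and smooth_\<alpha>: "smooth_function (tangent_atlas A) C \<alpha>"
    and smooth_\<beta>: "smooth_function (tangent_atlas A) C \<beta>"
    and sign: "\<xi> \<in> C \<Longrightarrow> \<alpha> \<xi> \<le> 0 \<and> 0 \<le> \<beta> \<xi> \<and> \<alpha> \<xi> < \<beta> \<xi>"
    and lifetime: "maximal_geodesic A C G I x \<Longrightarrow> 0 \<in> I \<Longrightarrow>
      I = {t. \<alpha> (velocity A x 0) * t < 1 \<and> \<beta> (velocity A x 0) * t < 1}"
begin

text \<open>
  The time \<open>s\<close> of the changed geodesic is the time \<open>r * s + t\<close> of the original one, and
  \<open>\<alpha> v * (r * s + t) < 1\<close> means \<open>r * \<alpha> v / (1 - \<alpha> v * t) * s < 1\<close>. Comparing the two descriptions of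
  the lifetime of the changed geodesic gives the values at its initial velocity.
\<close>

lemma slopes_affine:
  assumes x: "maximal_geodesic A C G I x" and t: "0 \<in> I" "t \<in> I" and r: "r > 0"
  defines "v \<equiv> velocity A x 0"
  shows "\<alpha> (tscale r (velocity A x t)) = r * \<alpha> v / (1 - \<alpha> v * t)"
    and "\<beta> (tscale r (velocity A x t)) = r * \<beta> v / (1 - \<beta> v * t)"
proof -
  have xg: "geodesic A C G I x"
    using x by (simp add: maximal_geodesic_def)
  have C: "velocity A x s \<in> C" if "s \<in> I" for s
    using integral_curve_at(1)[OF geodesic_velocity[OF A G xg] that] .
  let ?w = "tscale r (velocity A x t)"
  have w: "?w \<in> C"
    using spray_region(3)[OF G C[OF t(2)] r] .
  note sv = sign[OF C[OF t(1)], folded v_def] and sw = sign[OF w]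
  have I: "I = {t. \<alpha> v * t < 1 \<and> \<beta> v * t < 1}"
    using lifetime[OF x t(1)] by (simp add: v_def)
  then have pos: "1 - \<alpha> v * t > 0" "1 - \<beta> v * t > 0"
    using t(2) by auto
  have "{s. r * s + t \<in> I} = {s. \<alpha> ?w * s < 1 \<and> \<beta> ?w * s < 1}"
    using lifetime[OF maximal_geodesic_affine(1)[OF A G x r, of t]]
      maximal_geodesic_affine(2)[OF A G x r, of 0 t] t(2) by simp
  moreover have "(r * s + t \<in> I) \<longleftrightarrow> r * \<alpha> v / (1 - \<alpha> v * t) * s < 1 \<and> r * \<beta> v / (1 - \<beta> v * t) * s < 1" for s
    unfolding I using pos by (simp add: field_simps)
  ultimately have eq: "{s. r * \<alpha> v / (1 - \<alpha> v * t) * s < 1 \<and> r * \<beta> v / (1 - \<beta> v * t) * s < 1} =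
      {s. \<alpha> ?w * s < 1 \<and> \<beta> ?w * s < 1}"
    by auto
  have "r * \<alpha> v / (1 - \<alpha> v * t) \<le> 0" "0 \<le> r * \<beta> v / (1 - \<beta> v * t)"
    using sv pos r by (auto simp: divide_nonpos_pos mult_nonneg_nonpos)
  from interval_slopes_unique[OF this _ _ eq] sw
  show "\<alpha> ?w = r * \<alpha> v / (1 - \<alpha> v * t)" "\<beta> ?w = r * \<beta> v / (1 - \<beta> v * t)"
    by auto
qed

lemmas slopes_flow = slopes_affine[where r = 1, simplified]

lemma slopes_homogeneous:
  assumes "\<xi> \<in> C" "r > 0"
  shows "\<alpha> (tscale r \<xi>) = r * \<alpha> \<xi>" "\<beta> (tscale r \<xi>) = r * \<beta> \<xi>"
proof -
  obtain I x where "maximal_geodesic A C G I x" "0 \<in> I" "velocity A x 0 = \<xi>"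
    using maximal_geodesic_through[OF A G assms(1)] .
  then show "\<alpha> (tscale r \<xi>) = r * \<alpha> \<xi>" "\<beta> (tscale r \<xi>) = r * \<beta> \<xi>"
    using slopes_affine[of I x 0 r] assms(2) by auto
qed

text \<open>
  Minus the logarithmic derivative of \<open>\<beta> - \<alpha>\<close> along \<open>G\<close>, which is \<open>(\<beta>\<^sup>2 - \<alpha>\<^sup>2) / (\<beta> - \<alpha>)\<close>.
\<close>

definition \<kappa> where "\<kappa> \<xi> = - (\<alpha> \<xi> + \<beta> \<xi>)"

lemma smooth_\<kappa>: "smooth_function (tangent_atlas A) C \<kappa>"
  unfolding smooth_function_def smooth_on_def
proof (intro ballI allI)
  fix d k assume d: "d \<in> tangent_atlas A"
  let ?S = "snd d ` (fst d \<inter> C)"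
  have S: "open ?S"
    using spray_region(1)[OF G] d by (simp add: openin_differentiable_atlas[OF differentiable_tangent_atlas[OF A]])
  have "ck_on k ?S (\<lambda>z. (- 1) *\<^sub>R ((\<alpha> \<circ> chart_inv d) z + (\<beta> \<circ> chart_inv d) z))"
    using smooth_\<alpha> smooth_\<beta> d unfolding smooth_function_def smooth_on_def
    by (intro ck_on_scaleR ck_on_add ck_on_const S) blast+
  then show "ck_on k ?S (\<kappa> \<circ> chart_inv d)"
    by (rule ck_on_cong[OF S]) (simp add: \<kappa>_def)
qed

definition "completed_spray = projective_change A G \<kappa>"

lemma spray_completed_spray: "spray A C completed_spray"
  unfolding completed_spray_def
  by (rule spray_projective_change[OF A G smooth_\<kappa>]) (simp add: \<kappa>_def slopes_homogeneous algebra_simps)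

text \<open>
  Along \<open>G\<close> the derivative of \<open>\<alpha>\<close> is \<open>\<alpha>\<^sup>2\<close>, by differentiating \<open>\<alpha> / (1 - \<alpha> * s)\<close> at \<open>s = 0\<close>. The
  Liouville field adds \<open>- (\<alpha> + \<beta>) * \<alpha>\<close>, which leaves \<open>- \<alpha> * \<beta>\<close>. The same computation for \<open>\<beta>\<close> has the
  same result, so \<open>\<beta> - \<alpha>\<close> is conserved.
\<close>

lemma slopes_along_completed_spray:
  assumes \<xi>: "integral_curve (tangent_atlas A) C completed_spray J \<xi>" and t: "t \<in> J"
  shows "((\<lambda>t. \<alpha> (\<xi> t)) has_real_derivative - (\<alpha> (\<xi> t) * \<beta> (\<xi> t))) (at t)"
    and "((\<lambda>t. \<beta> (\<xi> t)) has_real_derivative - (\<alpha> (\<xi> t) * \<beta> (\<xi> t))) (at t)"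
proof -
  obtain I x where x: "maximal_geodesic A C G I x" "0 \<in> I" "velocity A x 0 = \<xi> t"
    using maximal_geodesic_through[OF A G integral_curve_at(1)[OF \<xi> t]] .
  have xg: "geodesic A C G I x"
    using x by (simp add: maximal_geodesic_def)
  have v: "integral_curve (tangent_atlas A) C G I (velocity A x)"
    by (rule geodesic_velocity[OF A G xg])
  have along: "((f \<circ> velocity A x) has_vector_derivative (f (\<xi> t))\<^sup>2) (at 0)"
    if "\<And>s. s \<in> I \<Longrightarrow> f (velocity A x s) = f (\<xi> t) / (1 - f (\<xi> t) * s)" for f :: "('m, 'e) tvec \<Rightarrow> real"
  proof (rule has_vector_derivative_transform_within_open[of "\<lambda>s. f (\<xi> t) / (1 - f (\<xi> t) * s)" _ _ I])
    show "((\<lambda>s. f (\<xi> t) / (1 - f (\<xi> t) * s)) has_vector_derivative (f (\<xi> t))\<^sup>2) (at 0)"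
      unfolding has_real_derivative_iff_has_vector_derivative[symmetric]
      by (auto intro!: derivative_eq_intros simp: power2_eq_square)
  qed (use v x(2) that in \<open>auto simp: integral_curve_def\<close>)
  have "((\<alpha> \<circ> \<xi>) has_vector_derivative (\<alpha> (\<xi> t))\<^sup>2 + \<kappa> (\<xi> t) * \<alpha> (\<xi> t)) (at t)"
    by (rule derivative_along_projective_change[OF A G smooth_\<alpha> slopes_homogeneous(1) v x(2,3) along
          \<xi>[unfolded completed_spray_def] t])
      (use slopes_flow(1)[OF x(1,2)] x(3) in auto)
  then show "((\<lambda>t. \<alpha> (\<xi> t)) has_real_derivative - (\<alpha> (\<xi> t) * \<beta> (\<xi> t))) (at t)"
    by (simp add: has_real_derivative_iff_has_vector_derivative o_def \<kappa>_def power2_eq_square algebra_simps)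
  have "((\<beta> \<circ> \<xi>) has_vector_derivative (\<beta> (\<xi> t))\<^sup>2 + \<kappa> (\<xi> t) * \<beta> (\<xi> t)) (at t)"
    by (rule derivative_along_projective_change[OF A G smooth_\<beta> slopes_homogeneous(2) v x(2,3) along
          \<xi>[unfolded completed_spray_def] t])
      (use slopes_flow(2)[OF x(1,2)] x(3) in auto)
  then show "((\<lambda>t. \<beta> (\<xi> t)) has_real_derivative - (\<alpha> (\<xi> t) * \<beta> (\<xi> t))) (at t)"
    by (simp add: has_real_derivative_iff_has_vector_derivative o_def \<kappa>_def power2_eq_square algebra_simps)
qed

text \<open>
  The claimed values satisfy the same equations \<open>\<alpha>' = \<beta>' = - \<alpha> \<beta>\<close> with the same initial values.
  As \<open>\<beta> - \<alpha>\<close> is constant, the equation for \<open>\<alpha>\<close> alone is quadratic, and the difference of two of its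
  solutions satisfies a linear equation.
\<close>

lemma slopes_explicit:
  assumes \<xi>: "integral_curve (tangent_atlas A) C completed_spray J \<xi>" and s0: "s0 \<in> J" and s: "s \<in> J"
  defines "p \<equiv> \<alpha> (\<xi> s0)" and "q \<equiv> \<beta> (\<xi> s0)"
  shows "\<alpha> (\<xi> s) = p * (1 - q * stretch p q (s - s0))"
    and "\<beta> (\<xi> s) = q * (1 - p * stretch p q (s - s0))"
proof -
  have J: "is_interval J"
    using \<xi> by (simp add: integral_curve_def)
  have pq: "p \<le> 0" "0 \<le> q" "p < q"
    using sign[OF integral_curve_at(1)[OF \<xi> s0]] by (auto simp: p_def q_def)
  note d = slopes_along_completed_spray[OF \<xi>]
  have diff: "\<beta> (\<xi> s) - \<alpha> (\<xi> s) = q - p" if s: "s \<in> J" for s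
  proof -
    have "\<beta> (\<xi> s) - \<alpha> (\<xi> s) - (q - p) = 0"
    proof (rule linear_ode_zero[OF J s0 s])
      show "((\<lambda>s. \<beta> (\<xi> s) - \<alpha> (\<xi> s) - (q - p)) has_real_derivative 0 * (\<beta> (\<xi> s) - \<alpha> (\<xi> s) - (q - p))) (at s)"
        if "s \<in> J" for s
        by (auto intro!: derivative_eq_intros d that)
    qed (auto simp: p_def q_def)
    then show ?thesis
      by simp
  qed
  let ?a = "\<lambda>s. p * (1 - q * stretch p q (s - s0))"
  have "\<alpha> (\<xi> s) - ?a s = 0"
  proof (rule linear_ode_zero[OF J s0 s])
    fix s assume s: "s \<in> J"
    have "(stretch p q has_real_derivative
        (1 - p * stretch p q (s - s0)) * (1 - q * stretch p q (s - s0))) (at (s - s0))"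
      by (rule stretch_derivative[OF pq])
    then have st: "((\<lambda>s. stretch p q (s - s0)) has_real_derivative
        (1 - p * stretch p q (s - s0)) * (1 - q * stretch p q (s - s0))) (at s)"
      using DERIV_shift[of "stretch p q" _ s "- s0"] by simp
    have \<beta>: "\<beta> (\<xi> s) = \<alpha> (\<xi> s) + (q - p)"
      using diff[OF s] by simp
    have "((\<lambda>s. \<alpha> (\<xi> s) - ?a s) has_real_derivative - (\<alpha> (\<xi> s) * \<beta> (\<xi> s)) -
        p * (0 - q * ((1 - p * stretch p q (s - s0)) * (1 - q * stretch p q (s - s0))))) (at s)"
      by (intro DERIV_diff DERIV_cmult d(1)[OF s] st DERIV_const)
    moreover have "- (\<alpha> (\<xi> s) * \<beta> (\<xi> s)) -
        p * (0 - q * ((1 - p * stretch p q (s - s0)) * (1 - q * stretch p q (s - s0)))) =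
        - (\<alpha> (\<xi> s) + ?a s + (q - p)) * (\<alpha> (\<xi> s) - ?a s)"
      unfolding \<beta> by (simp add: algebra_simps)
    ultimately show "((\<lambda>s. \<alpha> (\<xi> s) - ?a s) has_real_derivative
        - (\<alpha> (\<xi> s) + ?a s + (q - p)) * (\<alpha> (\<xi> s) - ?a s)) (at s)"
      by simp
  next
    have 1: "continuous_on J (\<lambda>s. \<alpha> (\<xi> s))"
      by (intro continuous_at_imp_continuous_on ballI DERIV_isCont[OF d(1)])
    have st: "continuous_on UNIV (stretch p q)"
      by (intro continuous_at_imp_continuous_on ballI DERIV_isCont[OF stretch_derivative[OF pq]])
    have 2: "continuous_on J (\<lambda>s. stretch p q (s - s0))"
      by (rule continuous_on_compose2[OF st]) (auto intro: continuous_on_diff)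
    show "continuous_on J (\<lambda>s. - (\<alpha> (\<xi> s) + ?a s + (q - p)))"
      by (intro continuous_on_minus continuous_on_add continuous_on_mult continuous_on_diff
          continuous_on_const 1 2)
  qed (simp add: p_def stretch_def)
  then show "\<alpha> (\<xi> s) = ?a s"
    by simp
  with diff[OF s] show "\<beta> (\<xi> s) = q * (1 - p * stretch p q (s - s0))"
    by (simp add: algebra_simps)
qed

text \<open>
  With \<open>\<phi>\<close> the given geodesic becomes a geodesic of \<open>G\<close> on \<open>J'\<close>, whose maximal extension is defined on
  the whole lifetime. With \<open>\<psi>\<close>, the inverse of \<open>\<phi>\<close>, the extension becomes a geodesic of the new spray
  on \<open>\<real>\<close>, which agrees with the given one on \<open>J\<close>.
\<close>

lemma complete_completed_spray: "complete_spray A C completed_spray"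
  unfolding complete_spray_def
proof (intro allI impI)
  fix J \<gamma> assume "geodesic A C completed_spray J \<gamma>"
  then obtain \<xi> where \<xi>: "integral_curve (tangent_atlas A) C completed_spray J \<xi>" and \<gamma>: "\<And>t. t \<in> J \<Longrightarrow> \<gamma> t = fst (\<xi> t)"
    by (auto simp: geodesic_def)
  have J: "open J" "is_interval J" "J \<noteq> {}"
    using \<xi> by (auto simp: integral_curve_def)
  then obtain s0 where s0: "s0 \<in> J"
    by blast
  have inC: "\<xi> s \<in> C" if "s \<in> J" for s
    using integral_curve_at(1)[OF \<xi> that] .
  define p q where "p = \<alpha> (\<xi> s0)" and "q = \<beta> (\<xi> s0)"
  have pq: "p \<le> 0" "0 \<le> q" "p < q"
    using sign[OF inC[OF s0]] by (auto simp: p_def q_def)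
  define \<phi> where "\<phi> t = s0 + stretch_inv p q t" for t
  define \<phi>' where "\<phi>' t = 1 / ((1 - p * t) * (1 - q * t))" for t
  define \<phi>'' where "\<phi>'' t = \<phi>' t * (p / (1 - p * t) + q / (1 - q * t))" for t
  define J' where "J' = {t \<in> {t. p * t < 1 \<and> q * t < 1}. \<phi> t \<in> J}"
  have d\<phi>: "(\<phi> has_vector_derivative \<phi>' t) (at t)" if "p * t < 1" "q * t < 1" for t
    using stretch_inv_derivative[OF pq(3) that]
    unfolding \<phi>_def[abs_def] \<phi>'_def has_real_derivative_iff_has_vector_derivative[symmetric]
    by (auto intro!: derivative_eq_intros)
  have d\<phi>': "(\<phi>' has_vector_derivative \<phi>'' t) (at t)" if "p * t < 1" "q * t < 1" for t
  proof -
    have alg: "- (inverse (P * Q) * (- p * Q + - q * P) * inverse (P * Q)) = 1 / (P * Q) * (p / P + q / Q)"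
      if "P \<noteq> 0" "Q \<noteq> 0" for P Q :: real
      using that by (simp add: field_simps)
    have nz: "1 - p * t \<noteq> 0" "1 - q * t \<noteq> 0"
      using that by auto
    have "((\<lambda>t. (1 - p * t) * (1 - q * t)) has_real_derivative
        - p * (1 - q * t) + - q * (1 - p * t)) (at t)"
      by (auto intro!: derivative_eq_intros)
    from DERIV_inverse'[OF this] show ?thesis
      unfolding alg[OF nz] using nz
      by (simp add: \<phi>'_def[abs_def] \<phi>''_def has_real_derivative_iff_has_vector_derivative divide_inverse)
  qed
  have "0 \<in> J'"
    using s0 by (simp add: J'_def \<phi>_def stretch_inv_def)
  have "integral_curve (tangent_atlas A) C (projective_change A completed_spray (\<lambda>\<xi>. - \<kappa> \<xi>)) J' (\<lambda>t. tscale (\<phi>' t) (\<xi> (\<phi> t)))"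
  proof (rule reparametrized_integral_curve[OF A spray_completed_spray _ \<xi>, where \<phi>'' = \<phi>''])
    show "spray A C (projective_change A completed_spray (\<lambda>\<xi>. - \<kappa> \<xi>))"
      using G by (simp add: completed_spray_def)
    have o: "open {t. p * t < 1 \<and> q * t < 1}"
      by (intro open_Collect_conj open_Collect_less continuous_intros)
    have "continuous_on {t. p * t < 1 \<and> q * t < 1} \<phi>"
      using d\<phi> has_vector_derivative_continuous by (intro continuous_at_imp_continuous_on) blast
    then have "open ({t. p * t < 1 \<and> q * t < 1} \<inter> \<phi> -` J)"
      using continuous_open_preimage[OF _ o J(1)] by blast
    then show "open J'"
      by (simp add: J'_def Int_def vimage_def)
    show "is_interval J'"
      unfolding is_interval_1
    proof (intro ballI allI impI)
      fix a b x assume a: "a \<in> J'" and b: "b \<in> J'" and x: "a \<le> x \<and> x \<le> b"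
      have "p * x \<le> p * a" "q * x \<le> q * b"
        using pq x by (auto intro: mult_left_mono mult_left_mono_neg)
      then have x1: "p * x < 1" "q * x < 1"
        using a b by (auto simp: J'_def)
      have "\<phi> a \<le> \<phi> x" "\<phi> x \<le> \<phi> b"
        using stretch_inv_mono[OF pq, of a x] stretch_inv_mono[OF pq, of x b] x x1 a b
        by (auto simp: \<phi>_def J'_def)
      then show "x \<in> J'"
        using J(2) a b x1 unfolding is_interval_1 J'_def by blast
    qed
    show "J' \<noteq> {}"
      using \<open>0 \<in> J'\<close> by blast
    fix t assume t: "t \<in> J'"
    then have t1: "p * t < 1" "q * t < 1" and \<phi>t: "\<phi> t \<in> J"
      by (auto simp: J'_def)
    show "\<phi> t \<in> J" "(\<phi> has_vector_derivative \<phi>' t) (at t)" "(\<phi>' has_vector_derivative \<phi>'' t) (at t)"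
      using \<phi>t d\<phi>[OF t1] d\<phi>'[OF t1] by auto
    show pos: "0 < \<phi>' t"
      using t1 by (simp add: \<phi>'_def)
    \<comment> \<open>By the explicit values of the slopes, the required second derivative is \<open>\<phi>''\<close>.\<close>
    have "stretch p q (\<phi> t - s0) = t"
      using stretch_stretch_inv[OF pq(3) t1] by (simp add: \<phi>_def)
    then have "\<alpha> (\<xi> (\<phi> t)) = p * (1 - q * t)" "\<beta> (\<xi> (\<phi> t)) = q * (1 - p * t)"
      using slopes_explicit[OF \<xi> s0 \<phi>t] by (simp_all add: p_def q_def)
    then have "- \<kappa> (tscale (\<phi>' t) (\<xi> (\<phi> t))) = \<phi>' t * (p * (1 - q * t) + q * (1 - p * t))"
      using slopes_homogeneous[OF inC[OF \<phi>t] pos] by (simp add: \<kappa>_def distrib_left)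
    also have "\<dots> = p / (1 - p * t) + q / (1 - q * t)"
      using t1 by (simp add: \<phi>'_def field_simps)
    finally show "\<phi>'' t = - \<kappa> (tscale (\<phi>' t) (\<xi> (\<phi> t))) * \<phi>' t"
      by (simp add: \<phi>''_def)
  qed
  then have \<eta>: "integral_curve (tangent_atlas A) C G J' (\<lambda>t. tscale (\<phi>' t) (\<xi> (\<phi> t)))"
    by (simp add: completed_spray_def)
  obtain I y where y: "maximal_geodesic A C G I y" and J'I: "J' \<subseteq> I"
    and y_eq: "\<And>t. t \<in> J' \<Longrightarrow> y t = fst (tscale (\<phi>' t) (\<xi> (\<phi> t)))"
    using maximal_geodesic_exists[OF A G geodesicI[OF \<eta>]] by metis
  have I0: "0 \<in> I"
    using \<open>0 \<in> J'\<close> J'I by blast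
  have yg: "geodesic A C G I y"
    using y by (simp add: maximal_geodesic_def)
  have y0: "velocity A y 0 = \<xi> s0"
    using velocity_lift[OF A G \<eta> y_eq \<open>0 \<in> J'\<close>] by (simp add: \<phi>_def \<phi>'_def stretch_inv_def)
  have I: "I = {t. p * t < 1 \<and> q * t < 1}"
    using lifetime[OF y I0] by (simp add: y0 p_def q_def)
  have vy: "integral_curve (tangent_atlas A) C G I (velocity A y)"
    by (rule geodesic_velocity[OF A G yg])
  define \<psi> where "\<psi> s = stretch p q (s - s0)" for s
  define \<psi>' where "\<psi>' s = (1 - p * \<psi> s) * (1 - q * \<psi> s)" for s
  have \<psi>: "p * \<psi> s < 1" "q * \<psi> s < 1" for s
    using stretch_range[OF pq] by (auto simp: \<psi>_def)
  then have \<psi>I: "\<psi> s \<in> I" for s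
    by (simp add: I)
  have d\<psi>: "(\<psi> has_real_derivative \<psi>' s) (at s)" for s
    using stretch_derivative[OF pq, of "s - s0"] DERIV_shift[of "stretch p q" _ s "- s0"]
    by (simp add: \<psi>_def[abs_def] \<psi>'_def)
  have "integral_curve (tangent_atlas A) C (projective_change A G \<kappa>) UNIV (\<lambda>s. tscale (\<psi>' s) (velocity A y (\<psi> s)))"
  proof (rule reparametrized_integral_curve[OF A G spray_completed_spray[unfolded completed_spray_def] vy])
    fix s
    show "\<psi> s \<in> I" "(\<psi> has_vector_derivative \<psi>' s) (at s)"
      using \<psi>I d\<psi> by (auto simp flip: has_real_derivative_iff_has_vector_derivative)
    show "(\<psi>' has_vector_derivative - (p * (1 - q * \<psi> s) + q * (1 - p * \<psi> s)) * \<psi>' s) (at s)"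
      unfolding \<psi>'_def[abs_def] has_real_derivative_iff_has_vector_derivative[symmetric]
      by (auto intro!: derivative_eq_intros d\<psi> simp: \<psi>'_def algebra_simps)
    show pos: "0 < \<psi>' s"
      using \<psi>[of s] by (simp add: \<psi>'_def)
    have "\<alpha> (tscale (\<psi>' s) (velocity A y (\<psi> s))) = \<psi>' s * p / (1 - p * \<psi> s)"
      "\<beta> (tscale (\<psi>' s) (velocity A y (\<psi> s))) = \<psi>' s * q / (1 - q * \<psi> s)"
      using slopes_affine[OF y I0 \<psi>I pos] by (simp_all add: y0 p_def q_def)
    then have "\<kappa> (tscale (\<psi>' s) (velocity A y (\<psi> s))) = - (p * (1 - q * \<psi> s) + q * (1 - p * \<psi> s))"
      using \<psi>[of s] by (simp add: \<kappa>_def \<psi>'_def)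
    then show "- (p * (1 - q * \<psi> s) + q * (1 - p * \<psi> s)) * \<psi>' s =
        \<kappa> (tscale (\<psi>' s) (velocity A y (\<psi> s))) * \<psi>' s"
      by simp
  qed auto
  from geodesicI[OF this] have "geodesic A C completed_spray UNIV (\<lambda>s. y (\<psi> s))"
    by (simp add: completed_spray_def geodesic_fst_velocity)
  moreover have "y (\<psi> s) = \<gamma> s" if s: "s \<in> J" for s
  proof -
    have \<phi>\<psi>: "\<phi> (\<psi> s) = s"
      using stretch_inv_stretch[OF pq] by (simp add: \<phi>_def \<psi>_def)
    then have "\<psi> s \<in> J'"
      using \<psi>[of s] s by (simp add: J'_def)
    then show ?thesis
      using y_eq[of "\<psi> s"] \<phi>\<psi> \<gamma>[OF s] by simp
  qed
  ultimately show "\<exists>\<gamma>'. geodesic A C completed_spray UNIV \<gamma>' \<and> (\<forall>t\<in>J. \<gamma>' t = \<gamma> t)"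
    by blast
qed

lemma projectively_complete: "projectively_complete A C G"
  unfolding projectively_complete_def
  using spray_completed_spray complete_completed_spray projectively_related_change[OF spray_region(2)[OF G]]
  unfolding completed_spray_def by blast

end


section \<open>Finite and infinite lifetimes\<close>

lemma complete_imp_positively_complete: "complete_spray A C G \<Longrightarrow> positively_complete_spray A C G"
  unfolding complete_spray_def positively_complete_spray_def by (metis UNIV_I subsetI)

lemma complete_imp_negatively_complete: "complete_spray A C G \<Longrightarrow> negatively_complete_spray A C G"
  unfolding complete_spray_def negatively_complete_spray_def by (metis UNIV_I subsetI)

lemma smooth_function_inverse:
  assumes C: "differentiable_atlas A" "openin (atlas_topology A) W"
    and f: "smooth_function A W f" "\<And>p. p \<in> W \<Longrightarrow> f p \<noteq> 0"
  shows "smooth_function A W (\<lambda>p. inverse (f p))"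
  unfolding smooth_function_def smooth_on_def
proof (intro ballI allI)
  fix d k assume d: "d \<in> A"
  let ?S = "snd d ` (fst d \<inter> W)"
  have S: "open ?S"
    using C d by (simp add: openin_differentiable_atlas)
  have "(f \<circ> chart_inv d) z \<noteq> 0" if "z \<in> ?S" for z
    using that f(2) chart_inv_chart[OF differentiable_atlas_inj[OF C(1) d]] by auto
  moreover have "ck_on k ?S (f \<circ> chart_inv d)"
    using f(1) d unfolding smooth_function_def smooth_on_def by blast
  ultimately have "ck_on k ?S (\<lambda>z. inverse ((f \<circ> chart_inv d) z))"
    by (rule ck_on_inverse[OF S])
  then show "ck_on k ?S ((\<lambda>p. inverse (f p)) \<circ> chart_inv d)"
    by (simp add: o_def)
qed

lemma smooth_function_zero: "smooth_function A W (\<lambda>_. 0)"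
  by (simp add: smooth_function_def smooth_on_def o_def ck_on_const)

lemma lower_end_iff: "a < 0 \<Longrightarrow> inverse a * t < 1 \<longleftrightarrow> a < (t::real)"
  by (simp add: field_simps)

lemma upper_end_iff: "0 < b \<Longrightarrow> inverse b * t < 1 \<longleftrightarrow> (t::real) < b"
  by (simp add: field_simps)

lemma velocity_in_region:
  assumes "smooth_atlas A" "spray A C G" "maximal_geodesic A C G I x" "t \<in> I"
  shows "velocity A x t \<in> C"
  using integral_curve_at(1)[OF geodesic_velocity[OF assms(1,2)] assms(4)] assms(3)
  by (simp add: maximal_geodesic_def)

theorem theorem1p3:
  fixes A :: "('m, 'e::euclidean_space) chart set"
    and C :: "('m, 'e) tvec set"
    and G :: "('m, 'e) tfield"
    and a b :: "('m, 'e) tvec \<Rightarrow> real"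
  assumes manifold: "smooth_manifold A"
    and spray: "spray A C G"
    and intervals:
      "(smooth_function (tangent_atlas A) C a \<and> (\<forall>\<xi>\<in>C. a \<xi> < 0) \<and>
        smooth_function (tangent_atlas A) C b \<and> (\<forall>\<xi>\<in>C. b \<xi> > 0) \<and>
        (\<forall>I x. maximal_geodesic A C G I x \<and> 0 \<in> I \<longrightarrow>
           I = {a (velocity A x 0) <..< b (velocity A x 0)})) \<or>
       (smooth_function (tangent_atlas A) C a \<and> (\<forall>\<xi>\<in>C. a \<xi> < 0) \<and>
        (\<forall>I x. maximal_geodesic A C G I x \<and> 0 \<in> I \<longrightarrow>
           I = {a (velocity A x 0) <..})) \<or>
       (smooth_function (tangent_atlas A) C b \<and> (\<forall>\<xi>\<in>C. b \<xi> > 0) \<and>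
        (\<forall>I x. maximal_geodesic A C G I x \<and> 0 \<in> I \<longrightarrow>
           I = {..< b (velocity A x 0)}))"
  shows "projectively_complete A C G \<and>
         projectively_positively_complete A C G \<and>
         projectively_negatively_complete A C G"
proof -
  have A: "smooth_atlas A"
    using manifold by (simp add: smooth_manifold_def)
  note inv = smooth_function_inverse[OF differentiable_tangent_atlas[OF A] spray_region(1)[OF spray]]
  note inC = velocity_in_region[OF A spray]
  have "\<exists>\<alpha> \<beta>. geodesic_lifetimes A C G \<alpha> \<beta>"
    using intervals
  proof (elim disjE conjE)
    assume a: "smooth_function (tangent_atlas A) C a" "\<forall>\<xi>\<in>C. a \<xi> < 0"
      and b: "smooth_function (tangent_atlas A) C b" "\<forall>\<xi>\<in>C. b \<xi> > 0"
      and I: "\<forall>I x. maximal_geodesic A C G I x \<and> 0 \<in> I \<longrightarrow>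
           I = {a (velocity A x 0) <..< b (velocity A x 0)}"
    have "geodesic_lifetimes A C G (\<lambda>\<xi>. inverse (a \<xi>)) (\<lambda>\<xi>. inverse (b \<xi>))"
    proof
      fix \<xi> assume "\<xi> \<in> C"
      then have "inverse (a \<xi>) < 0" "0 < inverse (b \<xi>)"
        using a b by auto
      then show "inverse (a \<xi>) \<le> 0 \<and> 0 \<le> inverse (b \<xi>) \<and> inverse (a \<xi>) < inverse (b \<xi>)"
        by linarith
    next
      fix I x assume x: "maximal_geodesic A C G I x" "0 \<in> I"
      then have "a (velocity A x 0) < 0" "0 < b (velocity A x 0)"
        using inC a b by blast+
      moreover have "I = {a (velocity A x 0) <..< b (velocity A x 0)}"
        using I x by blast
      ultimately show "I = {t. inverse (a (velocity A x 0)) * t < 1 \<and> inverse (b (velocity A x 0)) * t < 1}"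
        by (auto simp: lower_end_iff upper_end_iff)
    qed (use A spray inv a b in \<open>force+\<close>)
    then show ?thesis by blast
  next
    assume a: "smooth_function (tangent_atlas A) C a" "\<forall>\<xi>\<in>C. a \<xi> < 0"
      and I: "\<forall>I x. maximal_geodesic A C G I x \<and> 0 \<in> I \<longrightarrow> I = {a (velocity A x 0) <..}"
    have "geodesic_lifetimes A C G (\<lambda>\<xi>. inverse (a \<xi>)) (\<lambda>\<xi>. 0)"
    proof
      fix I x assume x: "maximal_geodesic A C G I x" "0 \<in> I"
      then have "a (velocity A x 0) < 0"
        using inC a by blast
      moreover have "I = {a (velocity A x 0) <..}"
        using I x by blast
      ultimately show "I = {t. inverse (a (velocity A x 0)) * t < 1 \<and> 0 * t < 1}"
        by (auto simp: lower_end_iff)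
    qed (use A spray inv a smooth_function_zero in \<open>force+\<close>)
    then show ?thesis by blast
  next
    assume b: "smooth_function (tangent_atlas A) C b" "\<forall>\<xi>\<in>C. b \<xi> > 0"
      and I: "\<forall>I x. maximal_geodesic A C G I x \<and> 0 \<in> I \<longrightarrow> I = {..< b (velocity A x 0)}"
    have "geodesic_lifetimes A C G (\<lambda>\<xi>. 0) (\<lambda>\<xi>. inverse (b \<xi>))"
    proof
      fix I x assume x: "maximal_geodesic A C G I x" "0 \<in> I"
      then have "0 < b (velocity A x 0)"
        using inC b by blast
      moreover have "I = {..< b (velocity A x 0)}"
        using I x by blast
      ultimately show "I = {t. 0 * t < 1 \<and> inverse (b (velocity A x 0)) * t < 1}"
        by (auto simp: upper_end_iff)
    qed (use A spray inv b smooth_function_zero in \<open>force+\<close>)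
    then show ?thesis by blast
  qed
  then have "projectively_complete A C G"
    using geodesic_lifetimes.projectively_complete by blast
  then show ?thesis
    unfolding projectively_complete_def projectively_positively_complete_def
      projectively_negatively_complete_def
    using complete_imp_positively_complete complete_imp_negatively_complete by blast
qed

end
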